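(* The functions sending $(1^n\,0\,1^a\,0\,1^b)$, where $1\le a\le b\le n$, to the differences $$c(n,a)\,c(n,b)-c(n,a-1)\,c(n,b+1)$$ and $$S(n+a,n)\,S(n+b,n)-S(n+a-1,n)\,S(n+b+1,n)$$ are both in $\#\mathsf{L}$.
   Context: $c(n,k)$ is the (unsigned) Stirling number of the first type: the number of permutations of $n$ elements with exactly $k$ cycles. $S(n,k)$ is the Stirling number of the second type: the number of set partitions of an $n$-element set into $k$ nonempty blocks. The alphabet is $\Sigma=\{0,1\}$; $1^a$ is the string of $a$ ones and juxtaposition is concatenation. A function given only on strings of a specified form is extended by $0$ to all other strings. $\#\mathsf{L}$ is the class of functions $f:\Sigma^*\to\mathbb{N}_0$ such that $f(x)$ is the number of accepting computation paths on input $x$ of a fixed nondeterministic Turing machine with read-only input tape that uses $O(\log|x|)$ work space and halts on every computation path. Equivalently: there are a polynomial $q$ and a deterministic $O(\log|x|)$-space Turing machine $M$ with an additional read-once, left-to-right witness tape such that $f(x)=\#\{w\in\Sigma^{q(|x|)}\mid M(x,w)=\mathsf{yes}\}$. *)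

theory Defs
  imports
    "HOL-Combinatorics.Combinatorics"
    "HOL-Library.Disjoint_Sets"
    "HOL-Library.Landau_Symbols"
begin

section \<open>Stirling numbers as counting functions\<close>

text \<open>
  The library introduces \<^const>\<open>stirling\<close> (unsigned, first kind) and \<^const>\<open>Stirling\<close> (second
  kind) by their recurrences. The two theorems of this section identify them with the numbers of
  permutations with \<open>k\<close> cycles (fixed points count as cycles) and of set partitions into \<open>k\<close> blocks.
\<close>

theorem card_partitions_eq_Stirling:
  assumes "finite A"
  shows "card {P. partition_on A P \<and> card P = k} = Stirling (card A) k"
  using assms
proof (induction A arbitrary: k rule: finite_induct)
  case empty
  show ?case by (cases k) (auto simp: partition_on_empty card_eq_0_iff conj_commute cong: conj_cong)
next
  case (insert a A)
  define X where "X = (\<lambda>k. {P. partition_on A P \<and> card P = k})"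
  have finX: "finite (X k)" for k
    by (rule finite_subset[OF _ finitely_many_partition_on[OF insert.hyps(1)]]) (auto simp: X_def)
  have finP: "finite P" if "partition_on A P" for P
    using that insert.hyps(1) by (rule finite_elements[rotated])
  define Y where "Y = {P. partition_on (insert a A) P \<and> card P = k}"
  define Y1 where "Y1 = {P\<in>Y. {a} \<in> P}"
  define Y2 where "Y2 = {P\<in>Y. {a} \<notin> P}"
  have finY: "finite Y"
    by (rule finite_subset[OF _ finitely_many_partition_on[of "insert a A"]])
      (use insert.hyps in \<open>auto simp: Y_def\<close>)
  have Y: "card Y = card Y1 + card Y2"
  proof -
    have "Y = Y1 \<union> Y2" "Y1 \<inter> Y2 = {}" by (auto simp: Y1_def Y2_def)
    then show ?thesis using finY by (metis card_Un_disjoint finite_Un)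
  qed
  define g where "g = (\<lambda>(Q, B). insert (insert a B) (Q - {B}))"
  have inA: "B \<subseteq> A" "a \<notin> B" "B \<noteq> {}" if "partition_on A Q" "B \<in> Q" for Q B
    using that insert.hyps by (auto simp: partition_on_def)
  have disj: "B \<inter> C = {}" if "partition_on S Q" "B \<in> Q" "C \<in> Q" "B \<noteq> C" for S Q B and C :: "'a set"
    using that by (auto simp: partition_on_def disjoint_def)
  have bij: "bij_betw g (SIGMA Q:X k. Q) Y2"
  proof (rule bij_betw_byWitness[where f' =
      "\<lambda>P. ((\<lambda>C. C - {a}) ` P, (THE C. C \<in> P \<and> a \<in> C) - {a})"])
    show "\<forall>z\<in>(SIGMA Q:X k. Q).
      ((\<lambda>C. C - {a}) ` g z, (THE C. C \<in> g z \<and> a \<in> C) - {a}) = z"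
    proof
      fix z assume "z \<in> (SIGMA Q:X k. Q)"
      then obtain Q B where z: "z = (Q, B)" and Q: "partition_on A Q" and B: "B \<in> Q"
        by (auto simp: X_def)
      have "(THE C. C \<in> g z \<and> a \<in> C) = insert a B"
        by (rule the_equality) (use inA[OF Q] in \<open>auto simp: g_def z\<close>)
      moreover have "(\<lambda>C. C - {a}) ` g z = Q"
      proof -
        have "(\<lambda>C. C - {a}) ` (Q - {B}) = Q - {B}"
          using inA[OF Q] by (force simp: image_iff)
        then show ?thesis using inA[OF Q B] B by (auto simp: g_def z)
      qed
      ultimately show "((\<lambda>C. C - {a}) ` g z, (THE C. C \<in> g z \<and> a \<in> C) - {a}) = z"
        using inA[OF Q B] by (simp add: z)
    qed
  next
    have ex: "\<exists>B. a \<notin> B \<and> B \<noteq> {} \<and> insert a B \<in> P \<and> (\<forall>C\<in>P. a \<in> C \<longrightarrow> C = insert a B)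
        \<and> (\<lambda>C. C - {a}) ` P = insert B (P - {insert a B}) \<and> B \<notin> P \<and> (THE C. C \<in> P \<and> a \<in> C) = insert a B"
      if "P \<in> Y2" for P
    proof -
      have P: "partition_on (insert a A) P" "{a} \<notin> P" using that by (auto simp: Y2_def Y_def)
      then obtain C where C: "C \<in> P" "a \<in> C" by (auto simp: partition_on_def)
      have u: "D = C" if "D \<in> P" "a \<in> D" for D
        using disj[OF P(1) that(1) C(1)] that C by auto
      define B where "B = C - {a}"
      have CB: "C = insert a B" "a \<notin> B" using C by (auto simp: B_def)
      have ne: "B \<noteq> {}" using C CB P by auto
      have nB: "B \<notin> P" using disj[OF P(1) _ C(1), of B] CB ne by blast
      have "(\<lambda>D. D - {a}) ` (P - {C}) = P - {C}"
        using u by (force simp: image_iff)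
      then have "(\<lambda>C. C - {a}) ` P = insert B (P - {insert a B})"
        using C CB(1) B_def by (metis image_insert insert_Diff)
      moreover have "(THE C. C \<in> P \<and> a \<in> C) = insert a B"
        using C u unfolding CB(1)[symmetric] by (intro the_equality) blast+
      moreover have "\<forall>D\<in>P. a \<in> D \<longrightarrow> D = insert a B" using u CB(1) by blast
      moreover have "insert a B \<in> P" using C(1) CB(1) by simp
      ultimately show ?thesis using CB(2) ne nB by (intro exI[of _ B] conjI)
    qed
    show "\<forall>P\<in>Y2. g ((\<lambda>C. C - {a}) ` P, (THE C. C \<in> P \<and> a \<in> C) - {a}) = P"
    proof
      fix P assume "P \<in> Y2"
      from ex[OF this] obtain B where "a \<notin> B" "insert a B \<in> P" "B \<notin> P"
        "(\<lambda>C. C - {a}) ` P = insert B (P - {insert a B})" "(THE C. C \<in> P \<and> a \<in> C) = insert a B"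
        by blast
      then show "g ((\<lambda>C. C - {a}) ` P, (THE C. C \<in> P \<and> a \<in> C) - {a}) = P"
        by (auto simp: g_def)
    qed
    show "g ` (SIGMA Q:X k. Q) \<subseteq> Y2"
    proof
      fix P assume "P \<in> g ` (SIGMA Q:X k. Q)"
      then obtain Q B where P: "P = insert (insert a B) (Q - {B})"
        and Q: "partition_on A Q" "card Q = k" and B: "B \<in> Q"
        by (auto simp: X_def g_def)
      note i = inA[OF Q(1)]
      have d: "disjnt C D" if "C \<in> P" "D \<in> P" "C \<noteq> D" for C D
        using that disj[OF Q(1)] i B unfolding P disjnt_def by blast
      have "\<Union>P = insert a A" using Q(1) B unfolding P partition_on_def by blast
      moreover have "{} \<notin> P" using i unfolding P by blast
      ultimately have "partition_on (insert a A) P" using d by (intro partition_onI) auto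
      moreover have "{a} \<notin> P" using i B unfolding P by blast
      moreover have "card P = k"
      proof -
        have "insert a B \<notin> Q - {B}" using i by blast
        then show ?thesis unfolding P using finP[OF Q(1)] Q(2) B
          by (metis card_Suc_Diff1 card_insert_disjoint finite_Diff)
      qed
      ultimately show "P \<in> Y2" by (simp add: Y2_def Y_def)
    qed
    show "(\<lambda>P. ((\<lambda>C. C - {a}) ` P, (THE C. C \<in> P \<and> a \<in> C) - {a})) ` Y2 \<subseteq> (SIGMA Q:X k. Q)"
    proof
      fix z assume "z \<in> (\<lambda>P. ((\<lambda>C. C - {a}) ` P, (THE C. C \<in> P \<and> a \<in> C) - {a})) ` Y2"
      then obtain P where P: "P \<in> Y2"
        and z: "z = ((\<lambda>C. C - {a}) ` P, (THE C. C \<in> P \<and> a \<in> C) - {a})" by blast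
      from ex[OF P] obtain B where B: "a \<notin> B" "B \<noteq> {}" "insert a B \<in> P" "B \<notin> P"
        "\<forall>C\<in>P. a \<in> C \<longrightarrow> C = insert a B"
        "(\<lambda>C. C - {a}) ` P = insert B (P - {insert a B})" "(THE C. C \<in> P \<and> a \<in> C) = insert a B"
        by blast
      have z: "z = (insert B (P - {insert a B}), B)"
        unfolding z B(6,7) using B(1) by simp
      have Pp: "partition_on (insert a A) P" "card P = k" using P by (auto simp: Y2_def Y_def)
      have "finite P" using Pp(1) insert.hyps(1) finite_elements by (metis finite_insert)
      then have "card (insert B (P - {insert a B})) = k"
        using card.remove[OF \<open>finite P\<close> B(3)] B(4) Pp(2) \<open>finite P\<close> by simp
      moreover have "partition_on A (insert B (P - {insert a B}))"
      proof (rule partition_onI)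
        have "B \<subseteq> A" using Pp(1) B(1,3) by (auto simp: partition_on_def)
        have U: "\<Union>P = insert a A" using Pp(1) by (simp add: partition_on_def)
        have "D \<subseteq> A" if "D \<in> P - {insert a B}" for D
        proof -
          have "a \<notin> D" using that B(5) by auto
          moreover have "D \<subseteq> insert a A" using that U[symmetric] by (simp add: Union_upper)
          ultimately show ?thesis by (simp add: subset_insert)
        qed
        note DA = this
        have cov: "\<exists>D\<in>insert B (P - {insert a B}). y \<in> D" if "y \<in> A" for y
        proof -
          from that have "y \<in> \<Union>P" unfolding U by simp
          then obtain D where "D \<in> P" "y \<in> D" by blast
          moreover have "y \<noteq> a" using that insert.hyps(2) by blast
          ultimately show ?thesis by (cases "D = insert a B") auto
        qed
        show "\<Union>(insert B (P - {insert a B})) = A"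
        proof (intro equalityI Union_least)
          show "A \<subseteq> \<Union>(insert B (P - {insert a B}))" using cov by blast
          show "D \<subseteq> A" if "D \<in> insert B (P - {insert a B})" for D
            using that DA \<open>B \<subseteq> A\<close> by blast
        qed
        show "disjnt C D" if "C \<in> insert B (P - {insert a B})" "D \<in> insert B (P - {insert a B})" "C \<noteq> D" for C D
          using that disj[OF Pp(1)] B(3) unfolding disjnt_def by blast
        show "{} \<notin> insert B (P - {insert a B})" using B(2) Pp(1) by (simp add: partition_on_def)
      qed
      ultimately show "z \<in> (SIGMA Q:X k. Q)" by (simp add: z X_def)
    qed
  qed
  have Y2: "card Y2 = k * Stirling (card A) k"
  proof -
    have "card Y2 = (\<Sum>Q\<in>X k. card Q)"
      using bij_betw_same_card[OF bij] finX finP by (subst card_SigmaI[symmetric]) (auto simp: X_def)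
    also have "\<dots> = (\<Sum>Q\<in>X k. k)" by (rule sum.cong) (auto simp: X_def)
    finally show ?thesis using insert.IH by (simp add: X_def mult.commute)
  qed
  have *: "partition_on (insert a A) (insert {a} Q) \<longleftrightarrow> partition_on A Q"
    if "\<forall>B\<in>Q. a \<notin> B" for Q
    using that insert.hyps by (subst partition_on_insert) (auto simp: disjnt_def)
  have Y1: "Y1 = insert {a} ` {Q. partition_on A Q \<and> Suc (card Q) = k}"
  proof (intro set_eqI iffI)
    fix P assume "P \<in> Y1"
    then have P: "partition_on (insert a A) P" "card P = k" "{a} \<in> P" by (auto simp: Y1_def Y_def)
    have na: "\<forall>B\<in>P - {{a}}. a \<notin> B" using disj[OF P(1) _ P(3)] by blast
    have "partition_on A (P - {{a}})" using *[OF na] P by (simp add: insert_absorb)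
    moreover have "Suc (card (P - {{a}})) = k"
      using P insert.hyps(1) finite_elements by (metis card_Suc_Diff1 finite_insert)
    ultimately show "P \<in> insert {a} ` {Q. partition_on A Q \<and> Suc (card Q) = k}"
      using P(3) by (intro image_eqI[of _ _ "P - {{a}}"]) auto
  next
    fix P assume "P \<in> insert {a} ` {Q. partition_on A Q \<and> Suc (card Q) = k}"
    then obtain Q where Q: "P = insert {a} Q" "partition_on A Q" "Suc (card Q) = k" by blast
    have na: "\<forall>B\<in>Q. a \<notin> B" using inA[OF Q(2)] by blast
    then have "{a} \<notin> Q" by blast
    then show "P \<in> Y1" using *[OF na] Q finP[OF Q(2)] by (simp add: Y1_def Y_def)
  qed
  have inj: "inj_on (insert {a}) {Q. partition_on A Q \<and> Suc (card Q) = k}"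
  proof (rule inj_onI)
    fix P Q
    assume "P \<in> {Q. partition_on A Q \<and> Suc (card Q) = k}" "Q \<in> {Q. partition_on A Q \<and> Suc (card Q) = k}"
      and eq: "insert {a} P = insert {a} Q"
    then have "{a} \<notin> P" "{a} \<notin> Q" using inA(2) by blast+
    then show "P = Q" using eq by (simp add: insert_ident)
  qed
  have Y1c: "card Y1 = (case k of 0 \<Rightarrow> 0 | Suc j \<Rightarrow> Stirling (card A) j)"
    unfolding Y1 card_image[OF inj] using insert.IH by (cases k) auto
  have "card Y = Stirling (card (insert a A)) k"
    unfolding Y Y1c Y2 using insert.hyps by (cases k) auto
  then show ?case by (simp add: Y_def)
qed

theorem card_permutations_eq_stirling:
  assumes "finite A"
  shows "card {p. p permutes A \<and> card (orbit p ` A) = k} = stirling (card A) k"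
  using assms
proof (induction A arbitrary: k rule: finite_induct)
  case empty
  show ?case by (cases k) auto
next
  case (insert a A)
  have cyc: "card (orbit (transpose a b \<circ> q) ` insert a A) =
      (if b = a then Suc (card (orbit q ` A)) else card (orbit q ` A))"
    if q: "q permutes A" and b: "b \<in> insert a A" for q b
  proof -
    have qa: "q a = a" using q insert.hyps(2) by (simp add: permutes_not_in)
    have sub: "orbit q x \<subseteq> A" if "x \<in> A" for x
      using q that by (rule permutes_orbit_subset)
    show ?thesis
    proof (cases "b = a")
      case True
      have "orbit q a = {a}" using qa by (simp add: orbit_eq_singleton_iff)
      moreover have "{a} \<notin> orbit q ` A" using sub insert.hyps(2) by blast
      ultimately show ?thesis using True insert.hyps(1) by simp
    next
      case False
      then have bA: "b \<in> A" using b by simp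
      define p where "p = transpose a b \<circ> q"
      have pa: "p a = b" using qa by (simp add: p_def)
      have p1: "p y = a" if "q y = b" for y using that by (simp add: p_def)
      have p2: "p y = q y \<and> q y \<noteq> a" if "q y \<noteq> b" "y \<noteq> a" for y
      proof -
        have "q y \<noteq> a" using that(2) qa permutes_inj[OF q] by (metis injD)
        then show ?thesis using that by (simp add: p_def transpose_def)
      qed
      have A1: "(y \<noteq> a \<longrightarrow> y \<in> orbit q x) \<and> (y = a \<longrightarrow> b \<in> orbit q x)"
        if "y \<in> orbit p x" "x \<in> A" for x y
        using that
      proof (induction rule: orbit.induct)
        case base
        then have "x \<noteq> a" using insert.hyps by blast
        then show ?case using p1[of x] p2[of x] orbit.base[of q x] by (cases "q x = b") auto
      next
        case (step y)
        then show ?case using p1[of y] p2[of y] pa False orbit.step[of y q x]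
          by (cases "y = a"; cases "q y = b") auto
      qed
      have A2: "y \<in> orbit p x \<and> (y = b \<longrightarrow> a \<in> orbit p x)"
        if "y \<in> orbit q x" "x \<in> A" for x y
        using that
      proof (induction rule: orbit.induct)
        case base
        then have "x \<noteq> a" using insert.hyps by blast
        then show ?case using p1[of x] p2[of x] pa orbit.base[of p x] orbit.step[of a p x]
          by (cases "q x = b") auto
      next
        case (step y)
        have "y \<noteq> a" using step.hyps sub[OF step.prems] insert.hyps by blast
        then show ?case using step p1[of y] p2[of y] pa orbit.step[of y p x] orbit.step[of a p x]
          by (cases "q y = b") auto
      qed
      define F where "F = (\<lambda>S. if b \<in> S then insert a S else S)"
      have orb: "orbit p x = F (orbit q x)" if x: "x \<in> A" for x
      proof -
        have "a \<notin> orbit q x" using sub[OF x] insert.hyps by blast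
        then show ?thesis using A1[OF _ x] A2[OF _ x] unfolding F_def by auto
      qed
      have perm: "permutation p"
        using q insert.hyps(1) permutation_permutes unfolding p_def
        by (metis permutation_compose permutation_swap_id)
      have "orbit p a = orbit p b"
        using orbit_cyclic_eq3[OF cyclic_on_orbit'[OF perm], of b a] orbit.base[of p a] pa by simp
      then have "orbit p ` insert a A = F ` orbit q ` A"
        using bA orb by (auto simp: image_image)
      moreover have "inj_on F (orbit q ` A)"
      proof (rule inj_onI)
        fix S T assume "S \<in> orbit q ` A" "T \<in> orbit q ` A" and eq: "F S = F T"
        then have "a \<notin> S" "a \<notin> T" using sub insert.hyps by blast+
        then show "S = T" using eq False unfolding F_def by (auto split: if_splits)
      qed
      ultimately show ?thesis using False by (simp add: card_image p_def)
    qed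
  qed
  define X where "X = (\<lambda>k. {q. q permutes A \<and> card (orbit q ` A) = k})"
  have finX: "finite (X k)" for k
    by (rule finite_subset[OF _ finite_permutations[OF insert.hyps(1)]]) (auto simp: X_def)
  define h where "h = (\<lambda>(b, q). transpose a b \<circ> q :: 'a \<Rightarrow> 'a)"
  define Z where "Z = {a} \<times> {q. q permutes A \<and> Suc (card (orbit q ` A)) = k} \<union> A \<times> X k"
  have ins: "{p. p permutes insert a A} = h ` (insert a A \<times> {q. q permutes A})"
    using permutes_insert[of a A] by (auto simp: h_def image_def) 
  have img: "{p. p permutes insert a A \<and> card (orbit p ` insert a A) = k} = h ` Z"
  proof -
    have "{p. p permutes insert a A \<and> card (orbit p ` insert a A) = k} =
        h ` {z \<in> insert a A \<times> {q. q permutes A}. card (orbit (h z) ` insert a A) = k}"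
    proof -
      have "{p \<in> h ` T. Q p} = h ` {z \<in> T. Q (h z)}" for T Q by blast
      from this[of "insert a A \<times> {q. q permutes A}" "\<lambda>p. card (orbit p ` insert a A) = k"]
      show ?thesis unfolding ins[symmetric] by simp
    qed
    also have "{z \<in> insert a A \<times> {q. q permutes A}. card (orbit (h z) ` insert a A) = k} = Z"
    proof (rule set_eqI)
      fix z :: "'a \<times> ('a \<Rightarrow> 'a)"
      obtain b q where z: "z = (b, q)" by fastforce
      have h: "h z = transpose a b \<circ> q" by (simp add: h_def z)
      have "z \<in> Z \<longleftrightarrow> q permutes A \<and> b \<in> insert a A \<and>
          (if b = a then Suc (card (orbit q ` A)) else card (orbit q ` A)) = k"
        using insert.hyps(2) unfolding Z_def X_def z by auto
      also have "\<dots> \<longleftrightarrow> q permutes A \<and> b \<in> insert a A \<and> card (orbit (h z) ` insert a A) = k"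
        unfolding h using cyc[of q b] by (auto simp del: image_insert)
      finally show "z \<in> {z \<in> insert a A \<times> {q. q permutes A}. card (orbit (h z) ` insert a A) = k} \<longleftrightarrow> z \<in> Z"
        unfolding z by blast
    qed
    finally show ?thesis .
  qed
  have inj: "inj_on h Z"
  proof (rule inj_onI)
    fix y z assume yz: "y \<in> Z" "z \<in> Z" and eq: "h y = h z"
    obtain b q where y: "y = (b, q)" by fastforce
    obtain c r where z: "z = (c, r)" by fastforce
    have "q permutes A" "r permutes A" using yz by (auto simp: Z_def X_def y z)
    then have "q a = a" "r a = a" using insert.hyps(2) by (simp_all add: permutes_not_in)
    moreover have eq': "transpose a b \<circ> q = transpose a c \<circ> r" using eq by (simp add: h_def y z)
    ultimately have bc: "b = c" by (metis comp_apply transpose_apply_first)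
    have "transpose a b \<circ> (transpose a b \<circ> q) = transpose a b \<circ> (transpose a b \<circ> r)"
      using eq' bc by simp
    then have "q = r" by (simp add: comp_assoc[symmetric])
    then show "y = z" using bc by (simp add: y z)
  qed
  have "card Z = card {q. q permutes A \<and> Suc (card (orbit q ` A)) = k} + card A * card (X k)"
  proof -
    have "finite {q. q permutes A \<and> Suc (card (orbit q ` A)) = k}"
      by (rule finite_subset[OF _ finite_permutations[OF insert.hyps(1)]]) auto
    then show ?thesis unfolding Z_def using finX insert.hyps
      by (subst card_Un_disjoint) (auto simp: card_cartesian_product)
  qed
  also have "\<dots> = stirling (card (insert a A)) k"
    using insert by (cases k) (auto simp: X_def)
  finally show ?case unfolding img card_image[OF inj] .
qed

section \<open>Nondeterministic Turing machines with a read-only input tape\<close>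

text \<open>
  The input \<open>x\<close> is written on cells \<open>1, \<dots>, |x|\<close> of the input tape, between two end markers on cells
  \<open>0\<close> and \<open>|x| + 1\<close>, which the input head cannot leave. The work tapes are infinite to the right; a
  head on cell \<open>0\<close> that is told to move left stays where it is.
\<close>

datatype input_symbol = Left_End | Bit bool | Right_End

datatype move = Move_Left | Stay | Move_Right

datatype ('q, 's) instr =
  Instr (src: 'q) (inp: input_symbol) (reads: "'s list")
    (dst: 'q) (inp_move: move) (writes: "('s \<times> move) list")

text \<open>
  The types of states and of work tape symbols may be infinite: finiteness of the set of
  instructions leaves only finitely many states and symbols in play.
\<close>

record ('q, 's) ntm =
  num_tapes :: nat
  blank :: 's
  start :: 'q
  accept :: "'q set"
  instrs :: "('q, 's) instr set"

definition wf_ntm :: "('q, 's) ntm \<Rightarrow> bool" where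
  "wf_ntm M \<longleftrightarrow> finite (instrs M) \<and>
     (\<forall>t\<in>instrs M. length (reads t) = num_tapes M \<and> length (writes t) = num_tapes M)"

text \<open>State, position of the input head, and content and head position of each work tape.\<close>

type_synonym ('q, 's) config = "'q \<times> nat \<times> ((nat \<Rightarrow> 's) \<times> nat) list"

definition init_config :: "('q, 's) ntm \<Rightarrow> ('q, 's) config" where
  "init_config M = (start M, 0, replicate (num_tapes M) (\<lambda>_. blank M, 0))"

definition input_at :: "bool list \<Rightarrow> nat \<Rightarrow> input_symbol" where
  "input_at x i =
     (if i = 0 then Left_End else if i \<le> length x then Bit (x ! (i - 1)) else Right_End)"

fun move_head :: "move \<Rightarrow> nat \<Rightarrow> nat" where
  "move_head Move_Left h = h - 1"
| "move_head Stay h = h"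
| "move_head Move_Right h = h + 1"

fun write_move :: "(nat \<Rightarrow> 's) \<times> nat \<Rightarrow> 's \<times> move \<Rightarrow> (nat \<Rightarrow> 's) \<times> nat" where
  "write_move (u, h) (s, d) = (u(h := s), move_head d h)"

fun enabled :: "('q, 's) ntm \<Rightarrow> bool list \<Rightarrow> ('q, 's) config \<Rightarrow> ('q, 's) instr set" where
  "enabled M x (q, i, ts) =
     {t \<in> instrs M. src t = q \<and> inp t = input_at x i \<and> reads t = map (\<lambda>(u, h). u h) ts}"

fun exec :: "bool list \<Rightarrow> ('q, 's) instr \<Rightarrow> ('q, 's) config \<Rightarrow> ('q, 's) config" where
  "exec x t (q, i, ts) =
     (dst t, min (move_head (inp_move t) i) (length x + 1), map2 write_move ts (writes t))"

text \<open>
  A computation is given by the list of the instructions it executes, so that two different choices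
  of an instruction are always counted as different computations.
\<close>

primrec computation ::
  "('q, 's) ntm \<Rightarrow> bool list \<Rightarrow> ('q, 's) config \<Rightarrow> ('q, 's) instr list \<Rightarrow> ('q, 's) config \<Rightarrow> bool"
where
  "computation M x c [] c' \<longleftrightarrow> c' = c"
| "computation M x c (t # p) c' \<longleftrightarrow> t \<in> enabled M x c \<and> computation M x (exec x t c) p c'"

definition halts_on_all_paths :: "('q, 's) ntm \<Rightarrow> bool" where
  "halts_on_all_paths M \<longleftrightarrow>
     (\<forall>x. \<not> (\<exists>t c. c 0 = init_config M \<and>
        (\<forall>i::nat. t i \<in> enabled M x (c i) \<and> c (Suc i) = exec x (t i) (c i))))"

definition accepting_paths :: "('q, 's) ntm \<Rightarrow> bool list \<Rightarrow> ('q, 's) instr list set" where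
  "accepting_paths M x =
     {p. \<exists>c. computation M x (init_config M) p c \<and> enabled M x c = {} \<and> fst c \<in> accept M}"

text \<open>
  On inputs of length \<open>n\<close>, all work tape heads stay on the first \<open>s n\<close> cells on every computation
  path. Since the number of tapes is constant, the \<open>O(log n)\<close> bound below is not affected by
  measuring each tape separately.
\<close>

definition uses_space :: "('q, 's) ntm \<Rightarrow> (nat \<Rightarrow> nat) \<Rightarrow> bool" where
  "uses_space M s \<longleftrightarrow>
     (\<forall>x p q i ts. computation M x (init_config M) p (q, i, ts) \<longrightarrow>
        (\<forall>(u, h)\<in>set ts. h < s (length x)))"

definition log_space :: "('q, 's) ntm \<Rightarrow> bool" where
  "log_space M \<longleftrightarrow> (\<exists>s. uses_space M s \<and> (\<lambda>n. real (s n)) \<in> O(\<lambda>n. ln (real n)))"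

lemma finite_accepting_paths:
  assumes "wf_ntm M" "halts_on_all_paths M"
  shows "finite (accepting_paths M x)"
proof -
  define R where "R = (\<lambda>c' c. \<exists>t\<in>enabled M x c. c' = exec x t c)"
  have fin: "finite (enabled M x c)" for c
    using assms(1) by (cases c) (auto simp: wf_ntm_def)
  have acc: "Wellfounded.accp R (init_config M)"
  proof (rule ccontr)
    assume *: "\<not> Wellfounded.accp R (init_config M)"
    have step: "\<exists>c'. R c' c \<and> \<not> Wellfounded.accp R c'" if "\<not> Wellfounded.accp R c" for c
      using that by (meson accp.intros)
    obtain g where g: "R (g c) c \<and> \<not> Wellfounded.accp R (g c)" if "\<not> Wellfounded.accp R c" for c
      using step by metis
    define c where "c = (\<lambda>i. (g ^^ i) (init_config M))"
    have nacc: "\<not> Wellfounded.accp R (c i)" for i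
      by (induction i) (use * g in \<open>auto simp: c_def\<close>)
    have "\<exists>t\<in>enabled M x (c i). c (Suc i) = exec x t (c i)" for i
      using g[OF nacc[of i]] by (auto simp: R_def c_def)
    then obtain t where "t i \<in> enabled M x (c i) \<and> c (Suc i) = exec x (t i) (c i)" for i
      by metis
    moreover have "c 0 = init_config M" by (simp add: c_def)
    ultimately show False
      using assms(2) unfolding halts_on_all_paths_def by blast
  qed
  have "finite {p. \<exists>c'. computation M x c p c'}" if "Wellfounded.accp R c" for c
    using that
  proof (induction rule: accp.induct)
    case (accI c)
    have "{p. \<exists>c'. computation M x c p c'} \<subseteq>
      insert [] (\<Union>t\<in>enabled M x c. (#) t ` {p. \<exists>c'. computation M x (exec x t c) p c'})"
    proof
      fix p assume "p \<in> {p. \<exists>c'. computation M x c p c'}"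
      then show "p \<in> insert []
          (\<Union>t\<in>enabled M x c. (#) t ` {p. \<exists>c'. computation M x (exec x t c) p c'})"
        by (cases p) (simp, force simp del: split_paired_Ex)
    qed
    moreover have "finite \<dots>"
      using fin accI.IH unfolding R_def by (intro finite.insertI finite_UN_I finite_imageI) blast+
    ultimately show ?case by (rule finite_subset)
  qed
  from this[OF acc] show ?thesis
    by (rule rev_finite_subset) (auto simp: accepting_paths_def)
qed


section \<open>The class \<open>#L\<close>\<close>

definition sharpL :: "(bool list \<Rightarrow> nat) set" where
  "sharpL = {f. \<exists>M :: (nat, nat) ntm. wf_ntm M \<and> halts_on_all_paths M \<and> log_space M \<and>
                  (\<forall>x. f x = card (accepting_paths M x))}"

text \<open>The string \<open>1\<^sup>n 0 1\<^sup>a 0 1\<^sup>b\<close>; its length is \<open>n + a + b + 2\<close>.\<close>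

definition unary_triple :: "nat \<Rightarrow> nat \<Rightarrow> nat \<Rightarrow> bool list" where
  "unary_triple n a b =
     replicate n True @ [False] @ replicate a True @ [False] @ replicate b True"

text \<open>
  Membership in \<open>#L\<close> of the function that sends \<open>1\<^sup>n 0 1\<^sup>a 0 1\<^sup>b\<close> with \<open>1 \<le> a \<le> b \<le> n\<close> to
  \<open>D n a b\<close> and all other strings to \<open>0\<close>. The values are integers, so that the subtraction in the
  differences is the true one and their nonnegativity is part of the claim.
\<close>

definition triple_fun_in_sharpL :: "(nat \<Rightarrow> nat \<Rightarrow> nat \<Rightarrow> int) \<Rightarrow> bool" where
  "triple_fun_in_sharpL D \<longleftrightarrow>
     (\<exists>f\<in>sharpL.
        (\<forall>n a b. 1 \<le> a \<and> a \<le> b \<and> b \<le> n \<longrightarrow> int (f (unary_triple n a b)) = D n a b) \<and>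
        (\<forall>x. (\<nexists>n a b. 1 \<le> a \<and> a \<le> b \<and> b \<le> n \<and> x = unary_triple n a b) \<longrightarrow> f x = 0))"

end

theory Submission
  imports Defs "HOL-Library.Countable" "HOL-Real_Asymp.Real_Asymp"
begin

text \<open>
  For functions \<open>f, g\<close> write \<open>minor f g a e = f a * g (a + e) - f (a - 1) * g (a + e + 1)\<close>, where
  the second product is dropped if \<open>a = 0\<close>. With \<open>e = b - a\<close>, the first difference is the minor of
  \<open>f = g = c(n, _)\<close> and the second one is the minor of \<open>f = g = h\<^sub>n\<close>, where
  \<open>h\<^sub>n k = S(n + k, n)\<close>.

  Since \<open>c(n + 1, k) = n c(n, k) + c(n, k - 1)\<close> and \<open>h\<^sub>n k = h\<^sub>n\<^sub>-\<^sub>1 k + n h\<^sub>n (k - 1)\<close>, both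
  minors satisfy recurrences with nonnegative coefficients. Write \<open>D n a e\<close> for the first minor. The
  recurrence for \<open>c\<close>, expanded in both rows, gives
  \<open>D (n + 1) a e = R (a - 1) (e + 1) + n R a e\<close> with \<open>R a e = D n a (e - 1) + n D n a e\<close>. Here
  \<open>e = 0\<close> contributes no term \<open>D n a (e - 1)\<close>, because it would be the minor
  \<open>c(n, a) c(n, a - 1) - c(n, a - 1) c(n, a) = 0\<close>; this cancellation is what removes the subtraction.
  The second minor is handled in the same way, in two half steps that go through the mixed minor of
  \<open>h\<^sub>n\<close> and \<open>h\<^sub>n\<^sub>-\<^sub>1\<close> (\<open>minor_cycle_num_Suc\<close>, \<open>minor_block_num_shorten_long\<close>,
  \<open>minor_block_num_shorten_short\<close>).

  A nondeterministic program with a few counters that are bounded by the length of the input can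
  unwind such a recurrence: it guesses one of the summands, and it realizes a factor \<open>n\<close> by a loop that
  can be left in exactly \<open>n\<close> ways (\<open>counts_Guess\<close>). The number of its accepting paths is then the
  value of the minor. A counter that is bounded by the length of the input fits in binary on
  logarithmically many cells of a work tape. So it remains to show that every such counter program can be
  run by a log-space Turing machine with the same number of accepting paths
  (\<open>counter_program_in_sharpL\<close>).
\<close>

section \<open>Counting the accepting paths of a Turing machine\<close>

text \<open>
  All work tape heads of the configuration are on the first \<open>B\<close> cells.
\<close>

definition heads_below :: "nat \<Rightarrow> ('q, 's) config \<Rightarrow> bool" where
  "heads_below B c \<longleftrightarrow> (\<forall>(u, h)\<in>set (snd (snd c)). h < B)"

text \<open>
  \<open>tm_counts M x B c m\<close>: every path from \<open>c\<close> on input \<open>x\<close> halts and keeps the work tape heads on the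
  first \<open>B\<close> cells, and exactly \<open>m\<close> paths accept. The inductive definition makes termination, space and
  the number of accepting paths provable together, backwards from the halting configurations.
\<close>

inductive tm_counts :: "('q, 's) ntm \<Rightarrow> bool list \<Rightarrow> nat \<Rightarrow> ('q, 's) config \<Rightarrow> int \<Rightarrow> bool"
  for M x B where
  halt: "heads_below B c \<Longrightarrow> enabled M x c = {} \<Longrightarrow>
    tm_counts M x B c (of_bool (fst c \<in> accept M))"
| step: "heads_below B c \<Longrightarrow> enabled M x c \<noteq> {} \<Longrightarrow> finite (enabled M x c) \<Longrightarrow>
    (\<And>t. t \<in> enabled M x c \<Longrightarrow> tm_counts M x B (exec x t c) (f t)) \<Longrightarrow>
    tm_counts M x B c (\<Sum>t\<in>enabled M x c. f t)"

lemma tm_counts_single: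
  assumes "heads_below B c" "enabled M x c = {t}" "tm_counts M x B (exec x t c) m"
  shows "tm_counts M x B c m"
  using tm_counts.step[of B c M x "\<lambda>_. m"] assms by simp

lemma tm_counts_pair:
  assumes "heads_below B c" "enabled M x c = {t, t'}" "t \<noteq> t'"
    and "tm_counts M x B (exec x t c) m" "tm_counts M x B (exec x t' c) m'"
  shows "tm_counts M x B c (m + m')"
proof -
  have "tm_counts M x B (exec x s c) (if s = t then m else m')" if "s \<in> enabled M x c" for s
    using that assms by auto
  from tm_counts.step[of B c M x, OF assms(1) _ _ this] show ?thesis
    using assms(2,3) by simp
qed

text \<open>
  The accepting computations that start in configuration \<open>c\<close>.
\<close>

definition accepting_from :: "('q, 's) ntm \<Rightarrow> bool list \<Rightarrow> ('q, 's) config \<Rightarrow> ('q, 's) instr list set"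
  where "accepting_from M x c =
    {p. \<exists>c'. computation M x c p c' \<and> enabled M x c' = {} \<and> fst c' \<in> accept M}"

lemma tm_counts_card:
  assumes "tm_counts M x B c m"
  shows "finite (accepting_from M x c) \<and> int (card (accepting_from M x c)) = m"
  using assms
proof (induction rule: tm_counts.induct)
  case (halt c)
  have "accepting_from M x c = (if fst c \<in> accept M then {[]} else {})"
  proof -
    have "p = []" if "computation M x c p c'" for p c'
      using that halt(2) by (cases p) auto
    moreover have "computation M x c [] c" by simp
    ultimately show ?thesis
      using halt(2) unfolding accepting_from_def by (force simp del: split_paired_Ex)
  qed
  then show ?case by simp
next
  case (step c f)
  let ?E = "enabled M x c" and ?A = "\<lambda>t. (#) t ` accepting_from M x (exec x t c)"
  have eq: "accepting_from M x c = (\<Union>t\<in>?E. ?A t)"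
  proof (intro set_eqI iffI)
    fix p assume "p \<in> accepting_from M x c"
    then obtain c' where c': "computation M x c p c'" "enabled M x c' = {}" "fst c' \<in> accept M"
      unfolding accepting_from_def by blast
    moreover from c' step.hyps(2) obtain t p' where p: "p = t # p'" by (cases p) auto
    ultimately have "t \<in> ?E" "p' \<in> accepting_from M x (exec x t c)"
      unfolding accepting_from_def by (auto simp del: enabled.simps split_paired_Ex)
    then show "p \<in> (\<Union>t\<in>?E. ?A t)" using p by blast
  next
    fix p assume "p \<in> (\<Union>t\<in>?E. ?A t)"
    then show "p \<in> accepting_from M x c"
      unfolding accepting_from_def by (auto simp del: enabled.simps split_paired_Ex)
  qed
  have "card (accepting_from M x c) = (\<Sum>t\<in>?E. card (?A t))"
    unfolding eq using step by (intro card_UN_disjoint) auto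
  also have "\<dots> = (\<Sum>t\<in>?E. card (accepting_from M x (exec x t c)))"
    by (intro sum.cong refl card_image) simp
  finally have "int (card (accepting_from M x c)) = (\<Sum>t\<in>?E. f t)"
    using step.IH by simp
  moreover have "finite (accepting_from M x c)"
    unfolding eq using step by auto
  ultimately show ?case by simp
qed

lemma tm_counts_halts:
  assumes "tm_counts M x B c m"
    and "d 0 = c" "\<And>i::nat. t i \<in> enabled M x (d i) \<and> d (Suc i) = exec x (t i) (d i)"
  shows False
  using assms
proof (induction arbitrary: d t rule: tm_counts.induct)
  case (halt c)
  then show ?case by blast
next
  case (step c f)
  have "t 0 \<in> enabled M x c" using step.prems by blast
  then show ?case
    using step.IH[of "t 0" "\<lambda>i. d (Suc i)" "\<lambda>i. t (Suc i)"] step.prems by metis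
qed

lemma tm_counts_heads_below:
  assumes "tm_counts M x B c m" "computation M x c p c'"
  shows "heads_below B c'"
  using assms
proof (induction p arbitrary: c m)
  case Nil
  then show ?case by (auto elim: tm_counts.cases)
next
  case (Cons t p)
  from Cons.prems(2) have t: "t \<in> enabled M x c" "computation M x (exec x t c) p c'" by auto
  from Cons.prems(1) t(1) obtain m' where "tm_counts M x B (exec x t c) m'"
    by (cases rule: tm_counts.cases) auto
  then show ?case using Cons.IH t(2) by blast
qed

section \<open>Counter programs\<close>

text \<open>
  A counter program maps each label to a command. It has finitely many registers that hold natural
  numbers, and it reads the input once from left to right. \<open>Inc r l\<close> increments register \<open>r\<close> and
  continues at \<open>l\<close>. \<open>Dec r l0 l1\<close> continues at \<open>l0\<close> if register \<open>r\<close> is zero, and otherwise decrements it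
  and continues at \<open>l1\<close>. \<open>Choose\<close> branches nondeterministically. \<open>Read l1 l0 le\<close> consumes an input bit
  and continues at \<open>l1\<close> or \<open>l0\<close> accordingly, or continues at \<open>le\<close> if the input is used up.
  \<open>Halt\<close> accepts or rejects.
\<close>

datatype 'l cmd =
    Halt bool
  | Inc nat 'l
  | Dec nat 'l 'l
  | Choose 'l 'l
  | Read 'l 'l 'l

text \<open>
  \<open>counts P V l xs rs m\<close>: started at label \<open>l\<close> with remaining input \<open>xs\<close> and register contents \<open>rs\<close>,
  every path of \<open>P\<close> halts, never increments a register beyond \<open>V\<close>, and exactly \<open>m\<close> paths accept. The
  two targets of a choice must differ, so that the two branches are different computations. The number
  is an integer because the recurrences for the differences are stated over the integers.
\<close>

inductive counts ::
  "('l \<Rightarrow> 'l cmd) \<Rightarrow> nat \<Rightarrow> 'l \<Rightarrow> bool list \<Rightarrow> nat list \<Rightarrow> int \<Rightarrow> bool"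
  for P V where
  halt: "P l = Halt ok \<Longrightarrow> m = of_bool ok \<Longrightarrow> counts P V l xs rs m"
| inc: "P l = Inc r l' \<Longrightarrow> r < length rs \<Longrightarrow> rs ! r < V \<Longrightarrow>
    counts P V l' xs (rs[r := Suc (rs ! r)]) m \<Longrightarrow> counts P V l xs rs m"
| dec_0: "P l = Dec r l0 l1 \<Longrightarrow> r < length rs \<Longrightarrow> rs ! r = 0 \<Longrightarrow>
    counts P V l0 xs rs m \<Longrightarrow> counts P V l xs rs m"
| dec_Suc: "P l = Dec r l0 l1 \<Longrightarrow> r < length rs \<Longrightarrow> rs ! r = Suc v \<Longrightarrow>
    counts P V l1 xs (rs[r := v]) m \<Longrightarrow> counts P V l xs rs m"
| choose: "P l = Choose l1 l2 \<Longrightarrow> l1 \<noteq> l2 \<Longrightarrow> counts P V l1 xs rs m1 \<Longrightarrow>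
    counts P V l2 xs rs m2 \<Longrightarrow> m = m1 + m2 \<Longrightarrow> counts P V l xs rs m"
| read_bit: "P l = Read l1 l0 le \<Longrightarrow> counts P V (if b then l1 else l0) xs rs m \<Longrightarrow>
    counts P V l (b # xs) rs m"
| read_end: "P l = Read l1 l0 le \<Longrightarrow> counts P V le [] rs m \<Longrightarrow> counts P V l [] rs m"

lemma counts_nonneg: "counts P V l xs rs m \<Longrightarrow> 0 \<le> m"
  by (induction rule: counts.induct) auto

section \<open>Binary counters\<close>

text \<open>
  The number with the given binary digits, least significant digit first.
\<close>

abbreviation binval :: "bool list \<Rightarrow> nat" where
  "binval \<equiv> horner_sum of_bool 2"

lemma binval_flip:
  "binval (replicate j False @ True # ds) = Suc (binval (replicate j True @ False # ds))"
  by (induction j) auto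

text \<open>
  Incrementing turns the leading ones into zeros and the first zero into a one; the missing digit after
  the end of the list counts as a zero.
\<close>

lemma binval_increment:
  assumes "es = [] \<or> (\<exists>es'. es = False # es')"
  shows "binval (replicate j False @ True # tl es) = Suc (binval (replicate j True @ es))"
  using assms by (induction j) auto

lemma Suc_binval_replicate_True: "Suc (binval (replicate j True)) = 2 ^ j"
  by (induction j) auto

lemma binval_replicate_False: "binval (replicate j False) = 0"
  by (induction j) auto

lemma split_leading_digits:
  obtains j es where "ds = replicate j c @ es" "es = [] \<or> (\<exists>es'. es = (\<not> c) # es')"
proof (induction ds arbitrary: thesis)
  case Nil
  then show ?case by (metis append_Nil replicate_0)
next
  case (Cons d ds)
  show ?case
  proof (cases "d = c")
    case True
    obtain j es where "ds = replicate j c @ es" "es = [] \<or> (\<exists>es'. es = (\<not> c) # es')"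
      using Cons.IH by blast
    then show ?thesis using Cons.prems[of "Suc j" es] True by simp
  next
    case False
    then show ?thesis using Cons.prems[of 0 "d # ds"] by auto
  qed
qed

text \<open>
  Tape symbols: \<open>0\<close> is the blank, \<open>1\<close> and \<open>2\<close> are the binary digits, and \<open>3\<close> temporarily replaces the
  digit on cell \<open>0\<close> while the head is away, so that the head can find its way back.
\<close>

abbreviation digit :: "bool \<Rightarrow> nat" where "digit b \<equiv> (if b then 2 else 1)"
abbreviation mark :: nat where "mark \<equiv> 3"

text \<open>
  The content of a work tape at rest: the digits from cell \<open>0\<close> on, followed by blanks.
\<close>

definition tape :: "bool list \<Rightarrow> nat \<Rightarrow> nat" where
  "tape ds i = (if i < length ds then digit (ds ! i) else 0)"

text \<open>
  A work tape at rest represents \<open>v\<close> in binary, possibly with leading zeros, with its head on cell \<open>0\<close>.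
  The number of digits is bounded in terms of the largest value \<open>V\<close> that the counter may ever take:
  a new digit is only appended when the value becomes the power of two with that digit. The summand
  \<open>1\<close> admits the empty list of digits when \<open>V = 0\<close>.
\<close>

definition represents :: "nat \<Rightarrow> nat \<Rightarrow> (nat \<Rightarrow> nat) \<times> nat \<Rightarrow> bool" where
  "represents V v T \<longleftrightarrow> (\<exists>ds. T = (tape ds, 0) \<and> binval ds = v \<and> 2 ^ length ds \<le> 2 * V + 1)"

lemma tape_le_3: "tape ds i \<le> 3"
  by (simp add: tape_def)

lemma tape_Nil: "tape [] = (\<lambda>_. 0)"
  by (simp add: tape_def fun_eq_iff)

section \<open>Compiling counter programs to Turing machines\<close>

text \<open>
  A command that changes a counter takes several machine steps. In phase \<open>Rest\<close> all work heads are on cell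
  \<open>0\<close>; \<open>Scan\<close> moves right to the first digit to be changed; \<open>Back\<close> returns and flips the digits passed;
  \<open>Fail\<close> returns and leaves them as they are, after no suitable digit has been found.
\<close>

datatype phase = Rest | Scan | Back | Fail

instance phase :: finite
proof
  have "(UNIV :: phase set) = {Rest, Scan, Back, Fail}" using phase.exhaust by blast
  then show "finite (UNIV :: phase set)" by (metis finite.emptyI finite_insert)
qed

instance input_symbol :: finite
proof
  have "i \<in> {Left_End, Bit True, Bit False, Right_End}" for i
    by (cases i) auto
  then have "(UNIV :: input_symbol set) = {Left_End, Bit True, Bit False, Right_End}"
    by blast
  then show "finite (UNIV :: input_symbol set)" by (metis finite.emptyI finite_insert)
qed

text \<open>
  New label and phase, move of the input head, symbol written to the tape of the command, and move of
  the head of that tape.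
\<close>

type_synonym 'l outcome = "('l \<times> phase) \<times> move \<times> nat \<times> move"

text \<open>
  \<open>update l c l0 l1\<close> skips the leading digits \<open>c\<close>, writes \<open>c\<close> over the first other digit, flips the
  skipped digits and continues at \<open>l1\<close>. With \<open>c = True\<close> this is an increment, in which a blank counts
  as the digit zero. With \<open>c = False\<close> it is a decrement; if it meets a blank, the value is zero, and it
  continues at \<open>l0\<close> with the tape unchanged.
\<close>

fun update :: "'l \<Rightarrow> bool \<Rightarrow> 'l \<Rightarrow> 'l \<Rightarrow> phase \<Rightarrow> nat \<Rightarrow> 'l outcome" where
  "update l c l0 l1 Rest s =
     (if s = digit c then ((l, Scan), Stay, mark, Move_Right)
      else if c \<or> s \<noteq> 0 then ((l1, Rest), Stay, digit c, Stay)
      else ((l0, Rest), Stay, s, Stay))"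
| "update l c l0 l1 Scan s =
     (if s = digit c then ((l, Scan), Stay, s, Move_Right)
      else if c \<or> s \<noteq> 0 then ((l, Back), Stay, digit c, Move_Left)
      else ((l, Fail), Stay, s, Move_Left))"
| "update l c l0 l1 Back s =
     (if s = mark then ((l1, Rest), Stay, digit (\<not> c), Stay)
      else ((l, Back), Stay, digit (\<not> c), Move_Left))"
| "update l c l0 l1 Fail s =
     (if s = mark then ((l0, Rest), Stay, digit c, Stay)
      else ((l, Fail), Stay, digit c, Move_Left))"

text \<open>
  The possible actions at label \<open>l\<close> with the given command, phase, input symbol and symbol on the tape
  of the command. A \<open>Read\<close> on the left end marker first moves to the first bit and stays at its label.
\<close>

fun outcomes :: "'l \<Rightarrow> 'l cmd \<Rightarrow> phase \<Rightarrow> input_symbol \<Rightarrow> nat \<Rightarrow> 'l outcome set" where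
  "outcomes l (Halt ok) ph i s = {}"
| "outcomes l (Inc r l') ph i s = {update l True l' l' ph s}"
| "outcomes l (Dec r l0 l1) ph i s = {update l False l0 l1 ph s}"
| "outcomes l (Choose l1 l2) ph i s = {((l1, Rest), Stay, s, Stay), ((l2, Rest), Stay, s, Stay)}"
| "outcomes l (Read l1 l0 le) ph i s =
     {(case i of Left_End \<Rightarrow> ((l, Rest), Move_Right, s, Stay)
       | Bit b \<Rightarrow> ((if b then l1 else l0, Rest), Move_Right, s, Stay)
       | Right_End \<Rightarrow> ((le, Rest), Stay, s, Stay))}"

text \<open>
  Register \<open>r\<close> is kept on work tape \<open>r\<close>. Commands without a register nominally act on tape \<open>0\<close>, whose
  symbol they write back.
\<close>

fun cmd_tape :: "'l cmd \<Rightarrow> nat" where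
  "cmd_tape (Inc r _) = r"
| "cmd_tape (Dec r _ _) = r"
| "cmd_tape _ = 0"

text \<open>
  Labels with phases, coded as natural numbers.
\<close>

definition state :: "'l::finite \<times> phase \<Rightarrow> nat" where "state = to_nat"

lemma state_eq_iff [simp]: "state p = state q \<longleftrightarrow> p = q"
  by (simp add: state_def inj_eq)

fun tm_instr ::
  "'l::finite \<times> phase \<Rightarrow> input_symbol \<Rightarrow> nat list \<Rightarrow> nat \<Rightarrow> 'l outcome \<Rightarrow> (nat, nat) instr" where
  "tm_instr q i ss r (q', d, w, d') =
     Instr (state q) i ss (state q') d ((map (\<lambda>s. (s, Stay)) ss)[r := (w, d')])"

text \<open>
  The Turing machine of a counter program with \<open>k\<close> registers. An instruction has to list the symbols on
  all tapes; so there is a copy for every combination of symbols on the tapes that are not operated on.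
\<close>

definition tm_of :: "nat \<Rightarrow> ('l::finite \<Rightarrow> 'l cmd) \<Rightarrow> 'l \<Rightarrow> (nat, nat) ntm" where
  "tm_of k P l0 = \<lparr>num_tapes = k, blank = 0, start = state (l0, Rest),
     accept = {state (l, Rest) | l. P l = Halt True},
     instrs = (\<Union>(l, ph)\<in>UNIV. \<Union>i\<in>UNIV. \<Union>ss\<in>{ss. set ss \<subseteq> {..3} \<and> length ss = k}.
       tm_instr (l, ph) i ss (cmd_tape (P l)) `
         outcomes l (P l) ph i (ss ! cmd_tape (P l)))\<rparr>"

lemma finite_outcomes: "finite (outcomes l c ph i s)"
  by (cases c) auto

lemma wf_tm_of: "wf_ntm (tm_of k P l0)"
proof -
  have "finite {ss :: nat list. set ss \<subseteq> {..3} \<and> length ss = k}"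
    by (rule finite_lists_length_eq) simp
  then show ?thesis
    by (auto simp: wf_ntm_def tm_of_def finite_outcomes)
qed

lemma accept_tm_of: "state (l, Rest) \<in> accept (tm_of k P l0) \<longleftrightarrow> P l = Halt True"
  by (auto simp: tm_of_def)

abbreviation scanned :: "((nat \<Rightarrow> nat) \<times> nat) list \<Rightarrow> nat list" where
  "scanned ts \<equiv> map (\<lambda>(u, h). u h) ts"

lemma enabled_tm_of:
  assumes "length ts = k" "\<forall>(u, p)\<in>set ts. u p \<le> 3" "cmd_tape (P l) < k"
  shows "enabled (tm_of k P l0) x (state (l, ph), h, ts) =
    tm_instr (l, ph) (input_at x h) (scanned ts) (cmd_tape (P l)) `
      outcomes l (P l) ph (input_at x h) (scanned ts ! cmd_tape (P l))"
proof -
  let ?r = "cmd_tape (P l)" and ?i = "input_at x h"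
  have ss: "set (scanned ts) \<subseteq> {..3}" "length (scanned ts) = k" using assms by auto
  show ?thesis
  proof (intro set_eqI iffI)
    fix t assume "t \<in> enabled (tm_of k P l0) x (state (l, ph), h, ts)"
    then have "t \<in> instrs (tm_of k P l0)"
      and t: "src t = state (l, ph)" "inp t = ?i" "reads t = scanned ts" by auto
    then obtain l' ph' i ss z where z: "z \<in> outcomes l' (P l') ph' i (ss ! cmd_tape (P l'))"
      "t = tm_instr (l', ph') i ss (cmd_tape (P l')) z"
      unfolding tm_of_def by auto
    then have "src t = state (l', ph')" "inp t = i" "reads t = ss" by (cases z; simp)+
    then show "t \<in> tm_instr (l, ph) ?i (scanned ts) ?r ` outcomes l (P l) ph ?i (scanned ts ! ?r)"
      using z t by auto
  next
    fix t assume "t \<in> tm_instr (l, ph) ?i (scanned ts) ?r ` outcomes l (P l) ph ?i (scanned ts ! ?r)"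
    then obtain z where z: "z \<in> outcomes l (P l) ph ?i (scanned ts ! ?r)"
      and t: "t = tm_instr (l, ph) ?i (scanned ts) ?r z" by blast
    have "t \<in> instrs (tm_of k P l0)"
      unfolding tm_of_def ntm.simps t
      by (rule UN_I[of "(l, ph)"], simp, unfold prod.case, rule UN_I[of ?i], simp,
          rule UN_I[of "scanned ts"]) (use ss z in auto)
    moreover have "src t = state (l, ph)" "inp t = ?i" "reads t = scanned ts"
      unfolding t by (cases z; simp)+
    ultimately show "t \<in> enabled (tm_of k P l0) x (state (l, ph), h, ts)"
      by simp
  qed
qed

lemma exec_tm_instr:
  assumes "r < length ts" "ts ! r = (u, p)" "h \<le> length x + 1"
  shows "exec x (tm_instr q i (scanned ts) r (q', d, w, d')) (s, h, ts) =
    (state q', min (move_head d h) (length x + 1), ts[r := (u(p := w), move_head d' p)])"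
proof -
  have "map2 write_move ts ((map (\<lambda>s. (s, Stay)) (scanned ts))[r := (w, d')]) =
      ts[r := (u(p := w), move_head d' p)]"
    using assms by (intro nth_equalityI) (auto simp: nth_list_update split: prod.splits)
  then show ?thesis by simp
qed


text \<open>
  One run of the compiled machine on an input \<open>x\<close>, with counter values bounded by \<open>V\<close> and work tape
  heads kept on the first \<open>B\<close> cells.
\<close>

locale compiled =
  fixes P :: "'l::finite \<Rightarrow> 'l cmd" and k :: nat and l0 :: 'l
    and x :: "bool list" and V B :: nat
  assumes k_pos: "0 < k" and cmd_tape_less: "\<And>l. cmd_tape (P l) < k"
    and B: "\<And>n. 2 ^ n \<le> 2 * V + 1 \<Longrightarrow> n < B"
begin

abbreviation "M \<equiv> tm_of k P l0"

text \<open>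
  A list of work tapes on which the machine is prepared for every scanned symbol and which respects the
  space bound.
\<close>

definition admissible :: "((nat \<Rightarrow> nat) \<times> nat) list \<Rightarrow> bool" where
  "admissible ts \<longleftrightarrow> length ts = k \<and> (\<forall>(u, p)\<in>set ts. u p \<le> 3 \<and> p < B)"

lemma admissible_update:
  "admissible ts \<Longrightarrow> u p \<le> 3 \<Longrightarrow> p < B \<Longrightarrow> admissible (ts[r := (u, p)])"
  unfolding admissible_def using set_update_subset_insert[of ts r "(u, p)"] by auto

lemma heads_below_admissible: "admissible ts \<Longrightarrow> heads_below B (q, h, ts)"
  unfolding admissible_def heads_below_def by auto

lemma enabled_admissible:
  assumes "admissible ts" "ts ! cmd_tape (P l) = (u, p)"
  shows "enabled M x (state (l, ph), h, ts) =
    tm_instr (l, ph) (input_at x h) (scanned ts) (cmd_tape (P l)) `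
      outcomes l (P l) ph (input_at x h) (u p)"
proof -
  have "scanned ts ! cmd_tape (P l) = u p"
    using assms cmd_tape_less[of l] by (simp add: admissible_def)
  moreover have "\<forall>(u, p)\<in>set ts. u p \<le> 3" "length ts = k"
    using assms(1) unfolding admissible_def by auto
  ultimately show ?thesis using cmd_tape_less enabled_tm_of by metis
qed

lemma single_step:
  assumes "admissible ts" "ts ! cmd_tape (P l) = (u, p)" "h \<le> length x + 1"
    and "outcomes l (P l) ph (input_at x h) (u p) = {(q, d, w, d')}"
    and "tm_counts M x B (state q, min (move_head d h) (length x + 1),
      ts[cmd_tape (P l) := (u(p := w), move_head d' p)]) m"
  shows "tm_counts M x B (state (l, ph), h, ts) m"
proof (rule tm_counts_single[OF heads_below_admissible[OF assms(1)]])
  show "enabled M x (state (l, ph), h, ts) =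
      {tm_instr (l, ph) (input_at x h) (scanned ts) (cmd_tape (P l)) (q, d, w, d')}"
    unfolding enabled_admissible[OF assms(1,2)] assms(4) by simp
  have "cmd_tape (P l) < length ts"
    using assms(1) cmd_tape_less by (simp add: admissible_def)
  from exec_tm_instr[OF this assms(2,3)] assms(5)
  show "tm_counts M x B (exec x (tm_instr (l, ph) (input_at x h) (scanned ts) (cmd_tape (P l))
      (q, d, w, d')) (state (l, ph), h, ts)) m"
    by simp
qed

text \<open>
  A command at label \<open>l\<close> that acts on tape \<open>r\<close> by \<open>update\<close>. All other tapes are those of \<open>ts\<close>.
\<close>

context
  fixes l r c f g h ts
  assumes update_cmd: "\<And>ph i s. outcomes l (P l) ph i s = {update l c f g ph s}"
    and r: "cmd_tape (P l) = r" and adm: "admissible ts" and h: "h \<le> length x + 1"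
begin

lemma update_step:
  assumes "u p \<le> 3" "p < B" "update l c f g ph (u p) = (q, Stay, w, d)"
    and "tm_counts M x B (state q, h, ts[r := (u(p := w), move_head d p)]) m"
  shows "tm_counts M x B (state (l, ph), h, ts[r := (u, p)]) m"
proof (rule single_step[where u = u and p = p and q = q and d = Stay and w = w and d' = d])
  have "r < length ts" using adm r cmd_tape_less by (auto simp: admissible_def)
  then show "ts[r := (u, p)] ! cmd_tape (P l) = (u, p)" using r by simp
  show "tm_counts M x B (state q, min (move_head Stay h) (length x + 1),
      ts[r := (u, p), cmd_tape (P l) := (u(p := w), move_head d p)]) m"
    using assms(4) h r by simp
qed (use assms admissible_update[OF adm] update_cmd h in auto)

lemma scan_right:
  assumes "p \<le> j" "j < B" "\<And>i. p \<le> i \<Longrightarrow> i < j \<Longrightarrow> u i = digit c"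
    and "tm_counts M x B (state (l, Scan), h, ts[r := (u, j)]) m"
  shows "tm_counts M x B (state (l, Scan), h, ts[r := (u, p)]) m"
  using assms(1,3)
proof (induction rule: inc_induct)
  case base
  show ?case using assms(4) .
next
  case (step p)
  have up: "u p = digit c" using step by simp
  have eq: "u(p := digit c) = u" using up by auto
  have IH: "tm_counts M x B (state (l, Scan), h, ts[r := (u, Suc p)]) m"
    using step by simp
  show ?case
    by (rule update_step[where q = "(l, Scan)" and w = "digit c" and d = Move_Right])
      (use step(2) assms(2) up eq IH in auto)
qed

lemma return_left:
  assumes "\<And>s. update l c f g ph s =
      (if s = mark then ((q, Rest), Stay, w, Stay) else ((l, ph), Stay, w, Move_Left))"
    and "p < B" "u 0 = mark" "\<And>i. 0 < i \<Longrightarrow> i \<le> p \<Longrightarrow> u i < mark"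
    and "tm_counts M x B (state (q, Rest), h, ts[r := (\<lambda>i. if i \<le> p then w else u i, 0)]) m"
  shows "tm_counts M x B (state (l, ph), h, ts[r := (u, p)]) m"
  using assms(2-5)
proof (induction p arbitrary: u)
  case 0
  have eq: "u(0 := w) = (\<lambda>i. if i \<le> 0 then w else u i)" by auto
  show ?case
    by (rule update_step[where q = "(q, Rest)" and w = w and d = Stay])
      (use 0 eq in \<open>auto simp: assms(1)\<close>)
next
  case (Suc p)
  have up: "u (Suc p) < mark" using Suc.prems by simp
  have eq: "(\<lambda>i. if i \<le> Suc p then w else u i) =
      (\<lambda>i. if i \<le> p then w else (u(Suc p := w)) i)" by auto
  have "tm_counts M x B (state (l, ph), h, ts[r := (u(Suc p := w), p)]) m"
    by (rule Suc.IH) (use Suc.prems in \<open>simp_all add: eq\<close>)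
  then have IH: "tm_counts M x B (state (l, ph), h,
      ts[r := (u(Suc p := w), move_head Move_Left (Suc p))]) m" by simp
  show ?case
    by (rule update_step[OF _ _ _ IH]) (use up Suc.prems(1) in \<open>auto simp: assms(1)\<close>)
qed

text \<open>
  The successful case of \<open>update\<close>: either the list ends after the leading digits \<open>c\<close> and \<open>c\<close> is appended
  (increment only), or the opposite digit follows.
\<close>

lemma flip_digits:
  assumes len: "length (replicate j c @ es) < B"
    and es: "es = [] \<and> c \<or> (\<exists>es'. es = (\<not> c) # es')"
    and result: "tm_counts M x B (state (g, Rest), h,
      ts[r := (tape (replicate j (\<not> c) @ c # tl es), 0)]) m"
  shows "tm_counts M x B (state (l, Rest), h, ts[r := (tape (replicate j c @ es), 0)]) m"
proof -
  let ?u = "tape (replicate j c @ es)"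
  have uj: "?u j \<noteq> digit c" "c \<or> ?u j \<noteq> 0"
    using es by (auto simp: tape_def nth_append)
  have ui: "?u i = digit c" if "i < j" for i
    using that by (simp add: tape_def nth_append)
  have jB: "j < B" using len by simp
  show ?thesis
  proof (cases "j = 0")
    case True
    have eq: "?u(0 := digit c) = tape (replicate j (\<not> c) @ c # tl es)"
      using es True by (auto simp: tape_def fun_eq_iff nth_Cons split: nat.splits)
    show ?thesis
      by (rule update_step[where q = "(g, Rest)" and w = "digit c" and d = Stay])
        (use eq uj True jB result in \<open>auto simp: tape_le_3\<close>)
  next
    case False
    let ?v = "?u(0 := mark)" and ?w = "?u(0 := mark, j := digit c)"
    have eq: "(\<lambda>i. if i \<le> j - 1 then digit (\<not> c) else ?w i) =
        tape (replicate j (\<not> c) @ c # tl es)"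
      using es False
      by (auto simp: tape_def fun_eq_iff nth_append nth_Cons split: nat.splits)
    have returned: "tm_counts M x B (state (l, Back), h, ts[r := (?w, j - 1)]) m"
    proof (rule return_left[where q = g and w = "digit (\<not> c)"])
      show "tm_counts M x B (state (g, Rest), h,
          ts[r := (\<lambda>i. if i \<le> j - 1 then digit (\<not> c) else ?w i, 0)]) m"
        unfolding eq by (rule result)
    qed (use jB False ui in auto)
    have "tm_counts M x B (state (l, Scan), h, ts[r := (?v, j)]) m"
      by (rule update_step[where q = "(l, Back)" and w = "digit c" and d = Move_Left])
        (use jB uj False returned in \<open>auto simp: tape_le_3\<close>)
    then have scan: "tm_counts M x B (state (l, Scan), h, ts[r := (?v, 1)]) m"
      by (rule scan_right[rotated 3]) (use jB ui False in auto)
    show ?thesis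
      by (rule update_step[where q = "(l, Scan)" and w = mark and d = Move_Right])
        (use ui[of 0] jB False scan in \<open>auto simp: tape_le_3\<close>)
  qed
qed

text \<open>
  The unsuccessful case of \<open>update\<close>: a decrement of zero.
\<close>

lemma find_no_digit:
  assumes c: "\<not> c" and jB: "j < B"
    and result: "tm_counts M x B (state (f, Rest), h, ts[r := (tape (replicate j c), 0)]) m"
  shows "tm_counts M x B (state (l, Rest), h, ts[r := (tape (replicate j c), 0)]) m"
proof -
  let ?u = "tape (replicate j c)"
  have uj: "?u j = 0" by (auto simp: tape_def)
  have ui: "?u i = digit c" if "i < j" for i
    using that by (simp add: tape_def)
  show ?thesis
  proof (cases "j = 0")
    case True
    have eq: "?u(0 := 0) = ?u" using uj True by auto
    show ?thesis
      by (rule update_step[where q = "(f, Rest)" and w = 0 and d = Stay])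
        (use eq uj True jB c result in auto)
  next
    case False
    let ?v = "?u(0 := mark)"
    have eq: "(\<lambda>i. if i \<le> j - 1 then digit c else ?v i) = ?u"
      using False by (auto simp: tape_def fun_eq_iff)
    have fail: "tm_counts M x B (state (l, Fail), h, ts[r := (?v, j - 1)]) m"
    proof (rule return_left[where q = f and w = "digit c"])
      show "tm_counts M x B (state (f, Rest), h,
          ts[r := (\<lambda>i. if i \<le> j - 1 then digit c else ?v i, 0)]) m"
        unfolding eq by (rule result)
    qed (use jB False ui in auto)
    have eq': "?v(j := 0) = ?v" using uj False by auto
    have "tm_counts M x B (state (l, Scan), h, ts[r := (?v, j)]) m"
      by (rule update_step[where q = "(l, Fail)" and w = 0 and d = Move_Left])
        (use jB uj False c fail eq' in auto)
    then have scan: "tm_counts M x B (state (l, Scan), h, ts[r := (?v, 1)]) m"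
      by (rule scan_right[rotated 3]) (use jB ui False in auto)
    show ?thesis
      by (rule update_step[where q = "(l, Scan)" and w = mark and d = Move_Right])
        (use ui[of 0] jB False scan in \<open>auto simp: tape_le_3\<close>)
  qed
qed

end

lemma admissible_represents:
  assumes "list_all2 (represents V) rs ts" "length rs = k"
  shows "admissible ts"
proof -
  have "u p \<le> 3 \<and> p < B" if "(u, p) \<in> set ts" for u p
  proof -
    from that assms(1) obtain v where "represents V v (u, p)"
      by (metis in_set_conv_nth list_all2_conv_all_nth)
    then show ?thesis using B[of 0] by (auto simp: represents_def tape_le_3)
  qed
  then show ?thesis using assms unfolding admissible_def by (auto dest: list_all2_lengthD)
qed

lemma list_all2_represents_update:
  assumes "list_all2 (represents V) rs ts"
    and "binval ds = v" "2 ^ length ds \<le> 2 * V + 1"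
  shows "list_all2 (represents V) (rs[r := v]) (ts[r := (tape ds, 0)])"
  using assms by (intro list_all2_update_cong) (auto simp: represents_def)

lemma represented_tape:
  assumes "list_all2 (represents V) rs ts" "r < length rs"
  obtains ds where "ts = ts[r := (tape ds, 0)]" "binval ds = rs ! r" "2 ^ length ds \<le> 2 * V + 1"
proof -
  have "represents V (rs ! r) (ts ! r)" using assms by (simp add: list_all2_conv_all_nth)
  then obtain ds where "ts ! r = (tape ds, 0)" "binval ds = rs ! r" "2 ^ length ds \<le> 2 * V + 1"
    unfolding represents_def by blast
  then show ?thesis using that by (metis list_update_id)
qed

lemma input_at_drop:
  assumes "0 < h" "h \<le> length x + 1"
  shows "input_at x h = (case drop (h - 1) x of [] \<Rightarrow> Right_End | b # _ \<Rightarrow> Bit b)"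
proof (cases "h = length x + 1")
  case False
  then have "h - 1 < length x" using assms by linarith
  from Cons_nth_drop_Suc[OF this] have "drop (h - 1) x = x ! (h - 1) # drop (Suc (h - 1)) x" by simp
  then show ?thesis using assms False by (simp add: input_at_def)
qed (simp add: input_at_def)

text \<open>
  The input head on cell \<open>h\<close> has \<open>drop (h - 1) x\<close> left to read. Truncated subtraction covers the initial
  cell \<open>0\<close> with the left end marker as well, where the whole input is left.
\<close>

lemma read_step:
  assumes P: "P l = Read l1 l2 le" and adm: "admissible ts" and h: "h \<le> length x + 1"
    and bit: "\<And>h b ys. 0 < h \<Longrightarrow> h \<le> length x \<Longrightarrow> xs = b # ys \<Longrightarrow> drop h x = ys \<Longrightarrow>
      tm_counts M x B (state (if b then l1 else l2, Rest), Suc h, ts) m"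
    and right_end: "xs = [] \<Longrightarrow> tm_counts M x B (state (le, Rest), length x + 1, ts) m"
    and xs: "drop (h - 1) x = xs"
  shows "tm_counts M x B (state (l, Rest), h, ts) m"
proof -
  obtain u p where up: "ts ! 0 = (u, p)" by fastforce
  have tape0: "cmd_tape (P l) = 0" using P by simp
  have same: "ts[0 := (u(p := u p), move_head Stay p)] = ts" using up by (simp flip: up)
  have inside: "tm_counts M x B (state (l, Rest), h, ts) m"
    if h: "0 < h" "h \<le> length x + 1" and xs: "drop (h - 1) x = xs" for h
  proof (cases xs)
    case Nil
    then have eq: "h = length x + 1" using h xs by simp
    have "input_at x h = Right_End" using input_at_drop[OF h] xs Nil by simp
    moreover have "tm_counts M x B (state (le, Rest), min (move_head Stay h) (length x + 1),
        ts[cmd_tape (P l) := (u(p := u p), move_head Stay p)]) m"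
      unfolding tape0 same using eq right_end[OF Nil] by simp
    ultimately show ?thesis
      using single_step[OF adm _ h(2), of l u p Rest "(le, Rest)" Stay "u p" Stay m] up tape0 P
      by simp
  next
    case (Cons b ys)
    then have le: "h \<le> length x"
      using h(2) xs by (cases "h = length x + 1") auto
    moreover have "drop h x = ys"
      using xs Cons h(1) by (cases h) (simp_all add: drop_Suc flip: tl_drop)
    ultimately have "tm_counts M x B (state (if b then l1 else l2, Rest), Suc h, ts) m"
      using bit h(1) Cons by blast
    then have "tm_counts M x B (state (if b then l1 else l2, Rest),
        min (move_head Move_Right h) (length x + 1),
        ts[cmd_tape (P l) := (u(p := u p), move_head Stay p)]) m"
      unfolding tape0 same using le by simp
    moreover have "input_at x h = Bit b" using input_at_drop[OF h] xs Cons by simp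
    ultimately show ?thesis
      using single_step[OF adm _ h(2), of l u p Rest "(if b then l1 else l2, Rest)" Move_Right
          "u p" Stay m] up tape0 P
      by simp
  qed
  show ?thesis
  proof (cases "h = 0")
    case True
    then have "tm_counts M x B (state (l, Rest), 1, ts) m"
      using inside[of 1] xs by simp
    then have "tm_counts M x B (state (l, Rest),
        min (move_head Move_Right h) (length x + 1),
        ts[cmd_tape (P l) := (u(p := u p), move_head Stay p)]) m"
      unfolding tape0 same using True by simp
    moreover have "input_at x h = Left_End" using True by (simp add: input_at_def)
    ultimately show ?thesis
      using single_step[OF adm _ h, of l u p Rest "(l, Rest)" Move_Right "u p" Stay m] up tape0 P
      by simp
  next
    case False
    then show ?thesis using inside h xs by simp
  qed
qed

lemma choose_step:
  assumes P: "P l = Choose l1 l2" "l1 \<noteq> l2" and adm: "admissible ts" and h: "h \<le> length x + 1"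
    and "tm_counts M x B (state (l1, Rest), h, ts) m1" "tm_counts M x B (state (l2, Rest), h, ts) m2"
  shows "tm_counts M x B (state (l, Rest), h, ts) (m1 + m2)"
proof -
  obtain u p where up: "ts ! 0 = (u, p)" by fastforce
  let ?t = "\<lambda>l'. tm_instr (l, Rest) (input_at x h) (scanned ts) 0 ((l', Rest), Stay, u p, Stay)"
  have same: "ts[0 := (u, p)] = ts" using up by (metis list_update_id)
  have len: "0 < length ts" using adm k_pos by (simp add: admissible_def)
  have ex: "exec x (?t l') (state (l, Rest), h, ts) = (state (l', Rest), h, ts)" for l'
    using exec_tm_instr[OF len up h, of "(l, Rest)" "input_at x h" "(l', Rest)" Stay "u p" Stay] h same
    by simp
  have "enabled M x (state (l, Rest), h, ts) = {?t l1, ?t l2}"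
    using enabled_admissible[OF adm, of l u p Rest h] P up by simp
  moreover have "?t l1 \<noteq> ?t l2" using P by simp
  ultimately show ?thesis
    using tm_counts_pair[OF heads_below_admissible[OF adm]] ex assms(5,6) by metis
qed

text \<open>
  The compiled machine has as many accepting paths as the counter program.
\<close>

theorem tm_counts_counts:
  assumes "counts P V l xs rs m" "length rs = k" "list_all2 (represents V) rs ts"
    and "drop (h - 1) x = xs" "h \<le> length x + 1"
  shows "tm_counts M x B (state (l, Rest), h, ts) m"
  using assms
proof (induction arbitrary: ts h rule: counts.induct)
  case (halt l ok m xs rs)
  have adm: "admissible ts" using admissible_represents halt by blast
  obtain u p where "ts ! cmd_tape (P l) = (u, p)" by fastforce
  then have "enabled M x (state (l, Rest), h, ts) = {}"
    using enabled_admissible[OF adm] halt(1) by simp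
  from tm_counts.halt[OF heads_below_admissible[OF adm] this] show ?case
    using halt(1,2) accept_tm_of[of l k P l0] by (cases ok) auto
next
  case (inc l r l' rs xs m)
  have adm: "admissible ts" using admissible_represents inc by blast
  obtain ds where ds: "ts = ts[r := (tape ds, 0)]" "binval ds = rs ! r" "2 ^ length ds \<le> 2 * V + 1"
    using represented_tape inc by blast
  obtain j es where es: "ds = replicate j True @ es" "es = [] \<or> (\<exists>es'. es = (\<not> True) # es')"
    by (rule split_leading_digits)
  let ?ds = "replicate j False @ True # tl es"
  have val: "binval ?ds = Suc (rs ! r)"
    using binval_increment[of es j] es(2) ds(2) unfolding es(1) by simp
  have "2 ^ length ?ds \<le> 2 * V + 1"
  proof (cases "es = []")
    case True
    then have "2 ^ j = Suc (rs ! r)"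
      using ds(2) es(1) Suc_binval_replicate_True[of j] by simp
    then show ?thesis using True inc.hyps(3) by simp
  next
    case False
    then show ?thesis using ds(3) es(1) by (cases es) auto
  qed
  then have "list_all2 (represents V) (rs[r := Suc (rs ! r)]) (ts[r := (tape ?ds, 0)])"
    using list_all2_represents_update inc.prems val by blast
  then have result: "tm_counts M x B (state (l', Rest), h, ts[r := (tape ?ds, 0)]) m"
    using inc.prems inc.IH by simp
  have "tm_counts M x B (state (l, Rest), h, ts[r := (tape ds, 0)]) m"
    unfolding es(1)
    by (rule flip_digits[where g = l' and f = l' and c = True])
      (use result[unfolded es(1)] B[OF ds(3)] es(2) inc.hyps(1) inc.prems(4) adm in \<open>auto simp: es(1)\<close>)
  then show ?case using ds(1) by simp
next
  case (dec_0 l r f g rs xs m)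
  have adm: "admissible ts" using admissible_represents dec_0 by blast
  obtain ds where ds: "ts = ts[r := (tape ds, 0)]" "binval ds = rs ! r" "2 ^ length ds \<le> 2 * V + 1"
    using represented_tape dec_0 by blast
  obtain j es where es: "ds = replicate j False @ es" "es = [] \<or> (\<exists>es'. es = (\<not> False) # es')"
    by (rule split_leading_digits)
  have "es = []"
    using es(2) ds(2) dec_0.hyps(3) unfolding es(1) by (auto simp: binval_flip)
  then have eq: "ds = replicate j False" using es(1) by simp
  have result: "tm_counts M x B (state (f, Rest), h, ts[r := (tape ds, 0)]) m"
    using dec_0.IH dec_0.prems ds(1) by simp
  have "tm_counts M x B (state (l, Rest), h, ts[r := (tape ds, 0)]) m"
    unfolding eq
    by (rule find_no_digit[where g = g and f = f and c = False])
      (use result[unfolded eq] B[OF ds(3)] dec_0.hyps(1) dec_0.prems(4) adm in \<open>auto simp: eq\<close>)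
  then show ?case using ds(1) by simp
next
  case (dec_Suc l r f g rs v xs m)
  have adm: "admissible ts" using admissible_represents dec_Suc by blast
  obtain ds where ds: "ts = ts[r := (tape ds, 0)]" "binval ds = rs ! r" "2 ^ length ds \<le> 2 * V + 1"
    using represented_tape dec_Suc by blast
  obtain j es where es: "ds = replicate j False @ es" "es = [] \<or> (\<exists>es'. es = (\<not> False) # es')"
    by (rule split_leading_digits)
  have "es \<noteq> []"
    using ds(2) dec_Suc.hyps(3) binval_replicate_False[of j] unfolding es(1) by auto
  then obtain es' where es': "es = True # es'" using es(2) by auto
  let ?ds = "replicate j True @ False # tl es"
  have "binval ?ds = v"
    using ds(2) dec_Suc.hyps(3) unfolding es(1) es' by (simp add: binval_flip)
  moreover have "2 ^ length ?ds \<le> 2 * V + 1"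
    using ds(3) unfolding es(1) es' by simp
  ultimately have "list_all2 (represents V) (rs[r := v]) (ts[r := (tape ?ds, 0)])"
    using list_all2_represents_update dec_Suc.prems by blast
  then have result: "tm_counts M x B (state (g, Rest), h, ts[r := (tape ?ds, 0)]) m"
    using dec_Suc.prems dec_Suc.IH by simp
  have "tm_counts M x B (state (l, Rest), h, ts[r := (tape ds, 0)]) m"
    unfolding es(1)
    by (rule flip_digits[where g = g and f = f and c = False])
      (use result[unfolded es(1)] B[OF ds(3)] es' dec_Suc.hyps(1) dec_Suc.prems(4) adm in \<open>auto simp: es(1)\<close>)
  then show ?case using ds(1) by simp
next
  case (choose l l1 l2 xs rs m1 m2 m)
  have "admissible ts" using admissible_represents choose by blast
  then show ?case using choose choose_step by blast
next
  case (read_bit l l1 l2 le b xs rs m)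
  have "admissible ts" using admissible_represents read_bit by blast
  then show ?case
    by (rule read_step[OF read_bit.hyps(1) _ read_bit.prems(4) _ _ read_bit.prems(3)])
      (use read_bit in auto)
next
  case (read_end l l1 l2 le rs m)
  have "admissible ts" using admissible_represents read_end by blast
  then show ?case
    by (rule read_step[OF read_end.hyps(1) _ read_end.prems(4) _ _ read_end.prems(3)])
      (use read_end in auto)
qed

end

text \<open>
  A bound on the number of digits of a counter bounded by \<open>n\<close>, plus the blank cell where a scan may end.
\<close>

definition space_bound :: "nat \<Rightarrow> nat" where
  "space_bound n = nat \<lceil>log 2 (2 * real n + 1)\<rceil> + 1"

lemma less_space_bound:
  assumes "2 ^ m \<le> 2 * n + 1"
  shows "m < space_bound n"
proof -
  have "(2::real) ^ m \<le> 2 * real n + 1"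
    using assms by (metis (mono_tags, lifting) of_nat_1 of_nat_add of_nat_le_iff of_nat_mult of_nat_numeral of_nat_power)
  then have "real m \<le> log 2 (2 * real n + 1)"
    by (simp add: le_log_iff powr_realpow)
  then show ?thesis unfolding space_bound_def by linarith
qed

lemma space_bound_bigo: "(\<lambda>n. real (space_bound n)) \<in> O(\<lambda>n. ln (real n))"
proof -
  have le: "norm (real (space_bound n)) \<le> norm (log 2 (2 * real n + 1) + 2)" for n
  proof -
    have "0 \<le> log 2 (2 * real n + 1)" by simp
    then show ?thesis unfolding space_bound_def real_norm_def by linarith
  qed
  have "(\<lambda>n. real (space_bound n)) \<in> O(\<lambda>n. log 2 (2 * real n + 1) + 2)"
    by (intro landau_o.big_mono always_eventually allI le)
  also have "(\<lambda>n. log 2 (2 * real n + 1) + 2) \<in> O(\<lambda>n. ln (real n))"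
    by real_asymp
  finally show ?thesis .
qed

text \<open>
  A counter program whose registers never exceed the length of the input counts a function in \<open>#L\<close>.
\<close>

theorem counter_program_in_sharpL:
  fixes P :: "'l::finite \<Rightarrow> 'l cmd"
  assumes k: "0 < k" "\<And>l. cmd_tape (P l) < k"
    and counts: "\<And>x. counts P (length x) l0 x (replicate k 0) (int (f x))"
  shows "f \<in> sharpL"
proof -
  let ?M = "tm_of k P l0"
  have run: "tm_counts ?M x (space_bound (length x)) (init_config ?M) (int (f x))" for x
  proof -
    interpret compiled P k l0 x "length x" "space_bound (length x)"
      by unfold_locales (use k less_space_bound in auto)
    have "represents (length x) 0 (\<lambda>_. 0, 0)"
      unfolding represents_def by (intro exI[of _ "[]"]) (simp add: tape_Nil)
    then have "list_all2 (represents (length x)) (replicate k 0) (replicate k (\<lambda>_. 0, 0))"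
      by (simp add: list_all2_conv_all_nth)
    from tm_counts_counts[OF counts _ this, of 0] show ?thesis
      by (simp add: init_config_def tm_of_def)
  qed
  have paths: "accepting_paths ?M x = accepting_from ?M x (init_config ?M)" for x
    by (simp add: accepting_paths_def accepting_from_def)
  have "halts_on_all_paths ?M"
    unfolding halts_on_all_paths_def using tm_counts_halts[OF run] by blast
  moreover have "uses_space ?M space_bound"
    unfolding uses_space_def using tm_counts_heads_below[OF run] by (fastforce simp: heads_below_def)
  then have "log_space ?M"
    unfolding log_space_def using space_bound_bigo by blast
  moreover have "f x = card (accepting_paths ?M x)" for x
    using tm_counts_card[OF run, of x] unfolding paths by simp
  ultimately show ?thesis
    unfolding sharpL_def using wf_tm_of by blast
qed

section \<open>The differences as two-by-two minors\<close>

text \<open>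
  The determinant with the rows \<open>f a, f (a - 1)\<close> and \<open>g (a + e + 1), g (a + e)\<close>; the value of \<open>f\<close>
  before \<open>0\<close> is read as zero.
\<close>

definition minor :: "(nat \<Rightarrow> int) \<Rightarrow> (nat \<Rightarrow> int) \<Rightarrow> nat \<Rightarrow> nat \<Rightarrow> int" where
  "minor f g a e = f a * g (a + e) - (case a of 0 \<Rightarrow> 0 | Suc a' \<Rightarrow> f a' * g (a + e + 1))"

text \<open>
  The unsigned Stirling numbers of the first kind, as integers.
\<close>

definition cycle_num :: "nat \<Rightarrow> nat \<Rightarrow> int" where
  "cycle_num n k = int (stirling n k)"

text \<open>
  \<open>block_num n\<close> is the function \<open>h\<^sub>n\<close>, the complete homogeneous symmetric polynomial at
  \<open>1, \<dots>, n\<close>, as a function of its degree.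
\<close>

definition block_num :: "nat \<Rightarrow> nat \<Rightarrow> int" where
  "block_num n k = int (Stirling (n + k) n)"

lemma cycle_num_rec:
  "cycle_num 0 k = of_bool (k = 0)"
  "cycle_num (Suc n) (Suc k) = int n * cycle_num n (Suc k) + cycle_num n k"
  "cycle_num n 0 = of_bool (n = 0)"
proof -
  show "cycle_num 0 k = of_bool (k = 0)" by (cases k) (simp_all add: cycle_num_def)
  show "cycle_num (Suc n) (Suc k) = int n * cycle_num n (Suc k) + cycle_num n k"
    by (simp add: cycle_num_def)
  show "cycle_num n 0 = of_bool (n = 0)" by (cases n) (simp_all add: cycle_num_def)
qed

lemma block_num_rec:
  "block_num 0 k = of_bool (k = 0)"
  "block_num n 0 = 1"
  "block_num n (Suc k) = block_num (n - 1) (Suc k) + int n * block_num n k"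
proof -
  show "block_num 0 k = of_bool (k = 0)" by (cases k) (simp_all add: block_num_def)
  show "block_num n 0 = 1" by (simp add: block_num_def)
  show "block_num n (Suc k) = block_num (n - 1) (Suc k) + int n * block_num n k"
    by (cases n) (simp_all add: block_num_def algebra_simps)
qed

lemma minor_0: "f = (\<lambda>k. of_bool (k = 0)) \<Longrightarrow> minor f f a e = of_bool (a = 0 \<and> e = 0)"
  by (auto simp: minor_def split: nat.split)

text \<open>
  \<open>R\<close> is the mixed minor of \<open>c(n, _)\<close> and \<open>c(n + 1, _)\<close>: the recurrence is expanded in one row at a
  time. For \<open>e = 0\<close> the term with \<open>e - 1\<close> is a determinant with two equal rows and vanishes.
\<close>

lemma minor_cycle_num_Suc:
  fixes n
  defines "D \<equiv> minor (cycle_num n) (cycle_num n)"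
  defines "R \<equiv> \<lambda>a e. (case e of 0 \<Rightarrow> 0 | Suc e' \<Rightarrow> D a e') + int n * D a e"
  shows "minor (cycle_num (Suc n)) (cycle_num (Suc n)) a e =
    (case a of 0 \<Rightarrow> 0 | Suc a' \<Rightarrow> R a' (Suc e)) + int n * R a e"
  by (cases a; cases e; cases "a - 1")
    (auto simp: D_def R_def minor_def cycle_num_rec algebra_simps split: nat.split)

text \<open>
  Expanding \<open>h\<^sub>n b = h\<^sub>n\<^sub>-\<^sub>1 b + n h\<^sub>n (b - 1)\<close> in the second row, and then in the first one. Both
  recurrences also hold for \<open>n = 0\<close>, where the truncated \<open>n - 1\<close> is \<open>0\<close> again.
\<close>

lemma minor_block_num_shorten_long:
  "minor (block_num n) (block_num n) a e =
    minor (block_num n) (block_num (n - 1)) a e +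
    int n * (case e of 0 \<Rightarrow> 0 | Suc e' \<Rightarrow> minor (block_num n) (block_num n) a e')"
  by (cases a; cases e) (auto simp: minor_def block_num_rec(2) block_num_rec(3)[of n] algebra_simps)

lemma minor_block_num_shorten_short:
  "minor (block_num n) (block_num (n - 1)) a e =
    minor (block_num (n - 1)) (block_num (n - 1)) a e +
    int n * (case a of 0 \<Rightarrow> 0 | Suc a' \<Rightarrow> minor (block_num n) (block_num (n - 1)) a' (Suc e))"
  by (cases a; cases "a - 1") (auto simp: minor_def block_num_rec(2) block_num_rec(3)[of n] algebra_simps)

section \<open>The counter program\<close>

text \<open>
  The registers \<open>0, \<dots>, 4\<close> hold \<open>n\<close>, \<open>a\<close>, \<open>e = b - a\<close>, a counter \<open>c\<close> and a scratch counter \<open>t\<close>. While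
  the input is read, \<open>c\<close> starts as a copy of \<open>n\<close> from which \<open>b\<close> is subtracted, to check \<open>b \<le> n\<close>, and \<open>t\<close>
  starts as a copy of \<open>a\<close> from which \<open>b\<close> is subtracted, the excess going to \<open>e\<close>, to check \<open>a \<le> b\<close>. The
  first bit after the first zero is treated separately to check \<open>1 \<le> a\<close>. After that, \<open>c\<close> is not used.

  The labels \<open>Perm_\<dots>\<close> and \<open>Part_\<dots>\<close> unwind the recurrences for cycle numbers and for block
  numbers, from the parameters \<open>n\<close>, \<open>a\<close>, \<open>e\<close> down to \<open>n = 0\<close>; to lower \<open>a\<close> with fixed \<open>b\<close> means to
  raise \<open>e\<close>.
\<close>

text \<open>
  The places where a factor \<open>n\<close> is needed: the element is inserted into an old cycle of the first or the
  second permutation, or the first or the second argument of \<open>h\<^sub>n\<close> is lowered.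
\<close>

datatype site = Keep_A | Keep_B | Grow_A | Grow_B

datatype label =
    Accept | Reject
  | Read_N | Add_N | Add_C | Read_First_A | Add_A | Add_T | Read_A
  | Read_B | Sub_C | Sub_T | Add_E | Check_T
  | Guess site | Guess_Move site | Guess_Stop site | Restore site | Restore_Move site
  | Final_A | Final_E
  | Perm_Next | Perm_A | Perm_Sub_A | Perm_Add_E | Perm_B | Perm_Sub_E
  | Part_B | Part_Sub_E | Part_A | Part_Sub_A | Part_Add_E | Part_Next

fun after :: "site \<Rightarrow> label" where
  "after Keep_A = Perm_B"
| "after Keep_B = Perm_Next"
| "after Grow_A = Part_Sub_A"
| "after Grow_B = Part_Sub_E"

text \<open>
  The parameter \<open>s\<close> is the label at which the program continues after having read the input; it selects
  one of the two recurrences.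
\<close>

fun program :: "label \<Rightarrow> label \<Rightarrow> label cmd" where
  "program s Accept = Halt True"
| "program s Reject = Halt False"
| "program s Read_N = Read Add_N Read_First_A Reject"
| "program s Add_N = Inc 0 Add_C"
| "program s Add_C = Inc 3 Read_N"
| "program s Read_First_A = Read Add_A Reject Reject"
| "program s Add_A = Inc 1 Add_T"
| "program s Add_T = Inc 4 Read_A"
| "program s Read_A = Read Add_A Read_B Reject"
| "program s Read_B = Read Sub_C Reject Check_T"
| "program s Sub_C = Dec 3 Reject Sub_T"
| "program s Sub_T = Dec 4 Add_E Read_B"
| "program s Add_E = Inc 2 Read_B"
| "program s Check_T = Dec 4 s Reject"
| "program s (Guess w) = Dec 0 Reject (Guess_Move w)"
| "program s (Guess_Move w) = Inc 4 (Guess_Stop w)"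
| "program s (Guess_Stop w) = Choose (Guess w) (Restore w)"
| "program s (Restore w) = Dec 4 (after w) (Restore_Move w)"
| "program s (Restore_Move w) = Inc 0 (Restore w)"
| "program s Final_A = Dec 1 Final_E Reject"
| "program s Final_E = Dec 2 Accept Reject"
| "program s Perm_Next = Dec 0 Final_A Perm_A"
| "program s Perm_A = Choose Perm_Sub_A (Guess Keep_A)"
| "program s Perm_Sub_A = Dec 1 Reject Perm_Add_E"
| "program s Perm_Add_E = Inc 2 Perm_B"
| "program s Perm_B = Choose Perm_Sub_E (Guess Keep_B)"
| "program s Perm_Sub_E = Dec 2 Reject Perm_Next"
| "program s Part_B = Choose Part_A (Guess Grow_B)"
| "program s Part_Sub_E = Dec 2 Reject Part_B"
| "program s Part_A = Choose Part_Next (Guess Grow_A)"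
| "program s Part_Sub_A = Dec 1 Reject Part_Add_E"
| "program s Part_Add_E = Inc 2 Part_A"
| "program s Part_Next = Dec 0 Final_A Part_B"

instance site :: finite
proof
  have "w \<in> {Keep_A, Keep_B, Grow_A, Grow_B}" for w by (cases w) auto
  then have "(UNIV :: site set) = {Keep_A, Keep_B, Grow_A, Grow_B}" by blast
  then show "finite (UNIV :: site set)" by (metis finite.emptyI finite_insert)
qed

instance label :: finite
proof
  let ?L = "{Accept, Reject, Read_N, Add_N, Add_C, Read_First_A, Add_A, Add_T, Read_A,
      Read_B, Sub_C, Sub_T, Add_E, Check_T, Final_A, Final_E,
      Perm_Next, Perm_A, Perm_Sub_A, Perm_Add_E, Perm_B, Perm_Sub_E,
      Part_B, Part_Sub_E, Part_A, Part_Sub_A, Part_Add_E, Part_Next}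
    \<union> range Guess \<union> range Guess_Move \<union> range Guess_Stop \<union> range Restore \<union> range Restore_Move"
  have "l \<in> ?L" for l by (cases l) auto
  then have "(UNIV :: label set) \<subseteq> ?L" by blast
  moreover have "finite ?L" by (intro finite_UnI finite_imageI finite.intros finite)
  ultimately show "finite (UNIV :: label set)" by (rule finite_subset)
qed

lemma counts_Reject: "counts (program s) V Reject xs rs 0"
  by (rule counts.halt, rule program.simps, simp)

lemma counts_Restore:
  assumes "counts (program s) V (after w) xs [n + t, a, e, c, 0] m" "n + t \<le> V"
  shows "counts (program s) V (Restore w) xs [n, a, e, c, t] m"
  using assms
proof (induction t arbitrary: n)
  case 0
  then show ?case by - (rule counts.dec_0, rule program.simps, simp_all)
next
  case (Suc t)
  then have "counts (program s) V (Restore w) xs [Suc n, a, e, c, t] m" by simp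
  then have "counts (program s) V (Restore_Move w) xs [n, a, e, c, t] m"
    using Suc.prems(2) by - (rule counts.inc, rule program.simps, simp_all)
  then show ?case by - (rule counts.dec_Suc[where v = t], rule program.simps, simp_all)
qed

text \<open>
  The loop moves units from register \<open>0\<close> to register \<open>4\<close>. It may be left after each unit, but not before
  the first one, and a path that empties register \<open>0\<close> without leaving is rejected. This makes \<open>n\<close>
  successful paths, on each of which \<open>Restore\<close> moves the units back.
\<close>

lemma counts_Guess:
  assumes "counts (program s) V (after w) xs [n, a, e, c, 0] m" "n \<le> V"
  shows "counts (program s) V (Guess w) xs [n, a, e, c, 0] (int n * m)"
proof -
  have "counts (program s) V (Guess w) xs [n', a, e, c, t] (int n' * m)" if "n' + t = n" for n' t
    using that
  proof (induction n' arbitrary: t)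
    case 0
    then show ?case
      using counts_Reject by - (rule counts.dec_0, rule program.simps, simp_all)
  next
    case (Suc n')
    then have "counts (program s) V (Guess w) xs [n', a, e, c, Suc t] (int n' * m)" by simp
    moreover have "counts (program s) V (Restore w) xs [n', a, e, c, Suc t] m"
      by (rule counts_Restore) (use Suc.prems assms in auto)
    ultimately have "counts (program s) V (Guess_Stop w) xs [n', a, e, c, Suc t] (int (Suc n') * m)"
      by - (rule counts.choose, rule program.simps, simp, assumption+, simp add: algebra_simps)
    then have "counts (program s) V (Guess_Move w) xs [n', a, e, c, t] (int (Suc n') * m)"
      using Suc.prems assms(2) by - (rule counts.inc, rule program.simps, simp_all)
    then show ?case by - (rule counts.dec_Suc[where v = n'], rule program.simps, simp_all)
  qed
  then show ?thesis by simp
qed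

lemma counts_Final_A:
  "counts (program s) V Final_A xs [n, a, e, c, t] (of_bool (a = 0 \<and> e = 0))"
proof -
  have acc: "counts (program s) V Accept xs [n, a, e, c, t] 1" for a e
    by (rule counts.halt, rule program.simps, simp)
  have "counts (program s) V Final_E xs [n, a, e, c, t] (of_bool (e = 0))" for a
  proof (cases e)
    case 0
    then show ?thesis using acc[of a 0] by - (rule counts.dec_0, rule program.simps, simp_all)
  next
    case (Suc e')
    then show ?thesis
      using counts_Reject by - (rule counts.dec_Suc[where v = e'], rule program.simps, simp_all)
  qed
  note E = this
  show ?thesis
  proof (cases a)
    case 0
    then show ?thesis using E[of 0] by - (rule counts.dec_0, rule program.simps, simp_all)
  next
    case (Suc a')
    then show ?thesis
      using counts_Reject by - (rule counts.dec_Suc[where v = a'], rule program.simps, simp_all)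
  qed
qed

lemma counts_Perm_Next:
  "a + e \<le> V \<Longrightarrow> n \<le> V \<Longrightarrow>
    counts (program s) V Perm_Next xs [n, a, e, c, 0] (minor (cycle_num n) (cycle_num n) a e)"
proof (induction n arbitrary: a e)
  case 0
  have "minor (cycle_num 0) (cycle_num 0) a e = of_bool (a = 0 \<and> e = 0)"
    by (rule minor_0) (simp add: cycle_num_rec fun_eq_iff)
  then show ?case using counts_Final_A[of s V xs 0 a e c 0]
    by - (rule counts.dec_0, rule program.simps, simp_all)
next
  case (Suc n)
  define D where "D = minor (cycle_num n) (cycle_num n)"
  define R where "R = (\<lambda>a e. (case e of 0 \<Rightarrow> 0 | Suc e' \<Rightarrow> D a e') + int n * D a e)"
  have n: "n \<le> V" using Suc.prems by simp
  have IH: "counts (program s) V Perm_Next xs [n, a, e, c, 0] (D a e)" if "a + e \<le> V" for a e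
    unfolding D_def by (rule Suc.IH) (use that n in simp_all)
  have B: "counts (program s) V Perm_B xs [n, a, e, c, 0] (R a e)" if "a + e \<le> V" for a e
  proof -
    have "counts (program s) V Perm_Sub_E xs [n, a, e, c, 0] (case e of 0 \<Rightarrow> 0 | Suc e' \<Rightarrow> D a e')"
    proof (cases e)
      case 0
      then show ?thesis
        using counts_Reject by - (rule counts.dec_0, rule program.simps, simp_all)
    next
      case (Suc e')
      then show ?thesis
        using IH[of a e'] that by - (rule counts.dec_Suc[where v = e'], rule program.simps, simp_all)
    qed
    moreover have "counts (program s) V (Guess Keep_B) xs [n, a, e, c, 0] (int n * D a e)"
      by (rule counts_Guess) (use IH that n in simp_all)
    ultimately show ?thesis
      unfolding R_def by - (rule counts.choose, rule program.simps, simp_all)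
  qed
  have "counts (program s) V Perm_Sub_A xs [n, a, e, c, 0] (case a of 0 \<Rightarrow> 0 | Suc a' \<Rightarrow> R a' (Suc e))"
  proof (cases a)
    case 0
    then show ?thesis
      using counts_Reject by - (rule counts.dec_0, rule program.simps, simp_all)
  next
    case (Suc a')
    then have "counts (program s) V Perm_Add_E xs [n, a', e, c, 0] (R a' (Suc e))"
      using B[of a' "Suc e"] Suc.prems by - (rule counts.inc, rule program.simps, simp_all)
    then show ?thesis
      using Suc by - (rule counts.dec_Suc[where v = a'], rule program.simps, simp_all)
  qed
  moreover have "counts (program s) V (Guess Keep_A) xs [n, a, e, c, 0] (int n * R a e)"
    by (rule counts_Guess) (use B Suc.prems n in simp_all)
  ultimately have "counts (program s) V Perm_A xs [n, a, e, c, 0]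
      (minor (cycle_num (Suc n)) (cycle_num (Suc n)) a e)"
    by - (rule counts.choose, rule program.simps, simp, assumption+,
      simp only: minor_cycle_num_Suc R_def D_def)
  then show ?case by - (rule counts.dec_Suc[where v = n], rule program.simps, simp_all)
qed

lemma counts_Part_A:
  assumes "n \<le> V" "a + e \<le> V"
    and "\<And>a e. a + e \<le> V \<Longrightarrow> counts (program s) V Part_Next xs [n, a, e, c, 0]
      (minor (block_num (n - 1)) (block_num (n - 1)) a e)"
  shows "counts (program s) V Part_A xs [n, a, e, c, 0]
    (minor (block_num n) (block_num (n - 1)) a e)"
  using assms(2)
proof (induction a arbitrary: e)
  case 0
  have "counts (program s) V Part_Sub_A xs [n, 0, e, c, 0] 0"
    using counts_Reject by - (rule counts.dec_0, rule program.simps, simp_all)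
  from counts_Guess[of s V Grow_A, simplified, OF this assms(1)]
  have guess: "counts (program s) V (Guess Grow_A) xs [n, 0, e, c, 0] 0" by simp
  show ?case
    by (rule counts.choose[OF _ _ assms(3)[of 0 e] guess], rule program.simps)
      (use 0 in \<open>simp_all add: minor_block_num_shorten_short[of n, unfolded One_nat_def]\<close>)
next
  case (Suc a)
  let ?m = "minor (block_num n) (block_num (n - 1)) a (Suc e)"
  have "counts (program s) V Part_A xs [n, a, Suc e, c, 0] ?m"
    using Suc by simp
  then have "counts (program s) V Part_Add_E xs [n, a, e, c, 0] ?m"
    using Suc.prems by - (rule counts.inc, rule program.simps, simp_all)
  then have "counts (program s) V Part_Sub_A xs [n, Suc a, e, c, 0] ?m"
    by - (rule counts.dec_Suc[where v = a], rule program.simps, simp_all)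
  then have guess: "counts (program s) V (Guess Grow_A) xs [n, Suc a, e, c, 0] (int n * ?m)"
    using counts_Guess[of s V Grow_A] assms(1) by simp
  show ?case
    by (rule counts.choose[OF _ _ assms(3)[of "Suc a" e] guess], rule program.simps)
      (use Suc.prems in \<open>simp_all add: minor_block_num_shorten_short[of n "Suc a", unfolded One_nat_def]\<close>)
qed

lemma counts_Part_B:
  assumes "n \<le> V" "a + e \<le> V"
    and "\<And>a e. a + e \<le> V \<Longrightarrow> counts (program s) V Part_Next xs [n, a, e, c, 0]
      (minor (block_num (n - 1)) (block_num (n - 1)) a e)"
  shows "counts (program s) V Part_B xs [n, a, e, c, 0] (minor (block_num n) (block_num n) a e)"
  using assms(2)
proof (induction e)
  case 0
  have "counts (program s) V Part_Sub_E xs [n, a, 0, c, 0] 0"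
    using counts_Reject by - (rule counts.dec_0, rule program.simps, simp_all)
  from counts_Guess[of s V Grow_B, simplified, OF this assms(1)]
  have guess: "counts (program s) V (Guess Grow_B) xs [n, a, 0, c, 0] 0" by simp
  show ?case
    by (rule counts.choose[OF _ _ counts_Part_A[OF assms(1) 0 assms(3)] guess], rule program.simps)
      (use 0 in \<open>simp_all add: minor_block_num_shorten_long[of n a 0]\<close>)
next
  case (Suc e)
  let ?m = "minor (block_num n) (block_num n) a e"
  have "counts (program s) V Part_B xs [n, a, e, c, 0] ?m"
    using Suc by simp
  then have "counts (program s) V Part_Sub_E xs [n, a, Suc e, c, 0] ?m"
    by - (rule counts.dec_Suc[where v = e], rule program.simps, simp_all)
  then have guess: "counts (program s) V (Guess Grow_B) xs [n, a, Suc e, c, 0] (int n * ?m)"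
    using counts_Guess[of s V Grow_B] assms(1) by simp
  show ?case
    by (rule counts.choose[OF _ _ counts_Part_A[OF assms(1) Suc.prems assms(3)] guess], rule program.simps)
      (use Suc.prems in \<open>simp_all add: minor_block_num_shorten_long[of n a "Suc e"]\<close>)
qed

lemma counts_Part_Next:
  "n \<le> V \<Longrightarrow> a + e \<le> V \<Longrightarrow> counts (program s) V Part_Next xs [n, a, e, c, 0]
    (minor (block_num (n - 1)) (block_num (n - 1)) a e)"
proof (induction n arbitrary: a e)
  case 0
  have "minor (block_num 0) (block_num 0) a e = of_bool (a = 0 \<and> e = 0)"
    by (rule minor_0) (simp add: block_num_rec fun_eq_iff)
  then show ?case using counts_Final_A[of s V xs 0 a e c 0]
    by - (rule counts.dec_0, rule program.simps, simp_all)
next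
  case (Suc n)
  then have "counts (program s) V Part_B xs [n, a, e, c, 0] (minor (block_num n) (block_num n) a e)"
    by (intro counts_Part_B) simp_all
  then show ?case by - (rule counts.dec_Suc[where v = n], rule program.simps, simp_all)
qed

text \<open>
  The last block is read with \<open>c\<close> units left for \<open>b\<close> and with \<open>t\<close> units to be matched before \<open>e\<close> grows.
  The value \<open>W e\<close> is the number of accepting paths after the input has been read.
\<close>

lemma counts_Read_B:
  assumes "\<And>e c. a + e \<le> V \<Longrightarrow> counts (program s) V s [] [n, a, e, c, 0] (W e)"
  shows "a + e + length xs \<le> V \<Longrightarrow> counts (program s) V Read_B xs [n, a, e, c, t]
    (if False \<notin> set xs \<and> length xs \<le> c \<and> t \<le> length xs then W (e + length xs - t) else 0)"
proof (induction xs arbitrary: e c t)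
  case Nil
  have "counts (program s) V Check_T [] [n, a, e, c, t] (if t = 0 then W e else 0)"
  proof (cases t)
    case 0
    then show ?thesis
      using assms Nil by - (rule counts.dec_0, rule program.simps, simp_all)
  next
    case (Suc t')
    then show ?thesis
      using counts_Reject by - (rule counts.dec_Suc[where v = t'], rule program.simps, simp_all)
  qed
  then show ?case by - (rule counts.read_end, rule program.simps, simp split: if_splits)
next
  case (Cons b xs)
  define Z where "Z = (\<lambda>xs e c t. if False \<notin> set xs \<and> length xs \<le> c \<and> t \<le> length xs
    then W (e + length xs - t) else 0)"
  have IH: "counts (program s) V Read_B xs [n, a, e, c, t] (Z xs e c t)"
    if "a + e + length xs \<le> V" for e c t
    unfolding Z_def by (rule Cons.IH[OF that])
  have sub_C: "counts (program s) V Sub_C xs [n, a, e, c, t] (Z (True # xs) e c t)"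
  proof (cases c)
    case 0
    then have "Z (True # xs) e c t = 0" by (simp add: Z_def)
    then show ?thesis
      using counts_Reject 0 by - (rule counts.dec_0, rule program.simps, simp_all)
  next
    case (Suc c')
    have "counts (program s) V Sub_T xs [n, a, e, c', t] (Z (True # xs) e c t)"
    proof (cases t)
      case 0
      have "Z (True # xs) e c t = Z xs (Suc e) c' t" using 0 Suc by (simp add: Z_def)
      then have "counts (program s) V Add_E xs [n, a, e, c', t] (Z (True # xs) e c t)"
        using IH[of "Suc e" c' t] Cons.prems
        by - (rule counts.inc, rule program.simps, simp_all)
      then show ?thesis using 0 by - (rule counts.dec_0, rule program.simps, simp_all)
    next
      case (Suc t')
      have "Z (True # xs) e c t = Z xs e c' t'" using Suc \<open>c = Suc c'\<close> by (simp add: Z_def)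
      then have "counts (program s) V Read_B xs [n, a, e, c', t'] (Z (True # xs) e c t)"
        using IH[of e c' t'] Cons.prems by simp
      then show ?thesis
        using Suc by - (rule counts.dec_Suc[where v = t'], rule program.simps, simp_all)
    qed
    then show ?thesis
      using Suc by - (rule counts.dec_Suc[where v = c'], rule program.simps, simp_all)
  qed
  have "counts (program s) V Read_B (b # xs) [n, a, e, c, t] (Z (b # xs) e c t)"
  proof (cases b)
    case True
    then show ?thesis
      using sub_C by - (rule counts.read_bit, rule program.simps, simp)
  next
    case False
    then have "Z (b # xs) e c t = 0" by (simp add: Z_def)
    then show ?thesis
      using counts_Reject False by - (rule counts.read_bit, rule program.simps, simp)
  qed
  then show ?case unfolding Z_def .
qed

lemma counts_Read_A:
  assumes "counts (program s) V Read_A ys [n, a + m, e, c, t + m] z" "a + m \<le> V" "t + m \<le> V"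
  shows "counts (program s) V Read_A (replicate m True @ ys) [n, a, e, c, t] z"
  using assms
proof (induction m arbitrary: a t)
  case (Suc m)
  then have "counts (program s) V Read_A (replicate m True @ ys) [n, Suc a, e, c, Suc t] z" by simp
  then have "counts (program s) V Add_T (replicate m True @ ys) [n, Suc a, e, c, t] z"
    using Suc.prems by - (rule counts.inc, rule program.simps, simp_all)
  then have "counts (program s) V Add_A (replicate m True @ ys) [n, a, e, c, t] z"
    using Suc.prems by - (rule counts.inc, rule program.simps, simp_all)
  then show ?case by - (simp, rule counts.read_bit, rule program.simps, simp)
qed simp

lemma counts_Read_N:
  assumes "counts (program s) V Read_N ys [n + m, a, e, c + m, t] z" "n + m \<le> V" "c + m \<le> V"
  shows "counts (program s) V Read_N (replicate m True @ ys) [n, a, e, c, t] z"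
  using assms
proof (induction m arbitrary: n c)
  case (Suc m)
  then have "counts (program s) V Read_N (replicate m True @ ys) [Suc n, a, e, Suc c, t] z" by simp
  then have "counts (program s) V Add_C (replicate m True @ ys) [Suc n, a, e, c, t] z"
    using Suc.prems by - (rule counts.inc, rule program.simps, simp_all)
  then have "counts (program s) V Add_N (replicate m True @ ys) [n, a, e, c, t] z"
    using Suc.prems by - (rule counts.inc, rule program.simps, simp_all)
  then show ?case by - (simp, rule counts.read_bit, rule program.simps, simp)
qed simp

lemma counts_Read_First_A:
  assumes "counts (program s) V Read_A ys [n, Suc m, 0, c, Suc m] z" "Suc m \<le> V"
  shows "counts (program s) V Read_First_A (replicate (Suc m) True @ ys) [n, 0, 0, c, 0] z"
proof -
  have "counts (program s) V Read_A (replicate m True @ ys) [n, 1, 0, c, 1] z"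
    by (rule counts_Read_A) (use assms in simp_all)
  then have "counts (program s) V Add_T (replicate m True @ ys) [n, 1, 0, c, 0] z"
    using assms(2) by - (rule counts.inc, rule program.simps, simp_all)
  then have "counts (program s) V Add_A (replicate m True @ ys) [n, 0, 0, c, 0] z"
    using assms(2) by - (rule counts.inc, rule program.simps, simp_all)
  then show ?thesis by - (simp, rule counts.read_bit, rule program.simps, simp)
qed

lemma ones_zero_eq_iff:
  "replicate n True @ False # xs = replicate m True @ False # ys \<longleftrightarrow> n = m \<and> xs = ys"
proof (induction n arbitrary: m)
  case 0
  show ?case by (cases m) auto
next
  case (Suc n)
  show ?case by (cases m) (simp_all add: Suc.IH)
qed

lemma ones_zero_neq_ones: "replicate n True @ False # xs \<noteq> replicate m True"
  by (metis in_set_conv_decomp in_set_replicate)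

lemma ones_cases:
  obtains (ones) m where "xs = replicate m True"
  | (zero) m ys where "xs = replicate m True @ False # ys"
proof -
  obtain m es where "xs = replicate m True @ es" "es = [] \<or> (\<exists>es'. es = (\<not> True) # es')"
    by (rule split_leading_digits)
  then show ?thesis using that by auto
qed

lemma unary_triple_eq_iff:
  "unary_triple n a b = replicate n' True @ False # xs \<longleftrightarrow>
    n = n' \<and> xs = replicate a True @ False # replicate b True"
  by (auto simp: unary_triple_def ones_zero_eq_iff)

text \<open>
  In the first case the input has fewer than two zeros, or no ones between the first two. Strings of
  the form \<open>1\<^sup>n 0 1\<^sup>0 0 1\<^sup>b\<close> belong to it and are rejected.
\<close>

lemma counts_program_cases:
  assumes W: "\<And>n a e c V. n \<le> V \<Longrightarrow> a + e \<le> V \<Longrightarrow>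
    counts (program s) V s [] [n, a, e, c, 0] (W n a e)"
  obtains (bad) "counts (program s) (length x) Read_N x [0, 0, 0, 0, 0] 0"
      "\<And>n a b. x = unary_triple n a b \<Longrightarrow> a = 0"
  | (good) n a ys where "x = replicate n True @ False # replicate (Suc a) True @ False # ys"
      "counts (program s) (length x) Read_N x [0, 0, 0, 0, 0]
        (if False \<notin> set ys \<and> length ys \<le> n \<and> Suc a \<le> length ys
         then W n (Suc a) (length ys - Suc a) else 0)"
proof (cases x rule: ones_cases)
  case (ones n)
  have "counts (program s) (length x) Read_N [] [0 + n, 0, 0, 0 + n, 0] 0"
    using counts_Reject by - (rule counts.read_end, rule program.simps, simp)
  from counts_Read_N[OF this] have "counts (program s) (length x) Read_N x [0, 0, 0, 0, 0] 0"
    using ones by simp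
  then show ?thesis
    using bad ones ones_zero_neq_ones unfolding unary_triple_def by (metis append_Cons append_Nil)
next
  case (zero n y)
  have start: "counts (program s) (length x) Read_N x [0, 0, 0, 0, 0] z"
    if "counts (program s) (length x) Read_First_A y [n, 0, 0, n, 0] z" for z
  proof -
    have "counts (program s) (length x) Read_N (False # y) [0 + n, 0, 0, 0 + n, 0] z"
      using that by - (rule counts.read_bit, rule program.simps, simp)
    from counts_Read_N[OF this] show ?thesis using zero by simp
  qed
  have triple: "y = replicate a True @ False # replicate b True" if "x = unary_triple n' a b" for n' a b
    using that zero unary_triple_eq_iff by metis
  show ?thesis
  proof (cases y rule: ones_cases)
    case (ones a)
    have "counts (program s) (length x) Read_First_A y [n, 0, 0, n, 0] 0"
    proof (cases a)
      case 0
      then show ?thesis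
        using counts_Reject ones by - (simp, rule counts.read_end, rule program.simps, simp)
    next
      case (Suc a')
      have "counts (program s) (length x) Read_A [] [n, Suc a', 0, n, Suc a'] 0"
        using counts_Reject by - (rule counts.read_end, rule program.simps, simp)
      from counts_Read_First_A[OF this] show ?thesis using Suc ones zero by simp
    qed
    then show ?thesis using bad start triple ones ones_zero_neq_ones by metis
  next
    case (zero a ys)
    show ?thesis
    proof (cases a)
      case 0
      then have "counts (program s) (length x) Read_First_A y [n, 0, 0, n, 0] 0"
        using counts_Reject zero by - (simp, rule counts.read_bit, rule program.simps, simp)
      moreover have "a' = 0" if "x = unary_triple n' a' b" for n' a' b
        using triple[OF that] zero 0 ones_zero_eq_iff by metis
      ultimately show ?thesis using bad start by metis
    next
      case (Suc a')
      define z where "z = (if False \<notin> set ys \<and> length ys \<le> n \<and> Suc a' \<le> length ys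
        then W n (Suc a') (length ys - Suc a') else 0)"
      have len: "length x = n + a + length ys + 2"
        using \<open>x = replicate n True @ False # y\<close> zero by simp
      have "counts (program s) (length x) s [] [n, Suc a', e, c, 0] (W n (Suc a') e)"
        if "Suc a' + e \<le> length x" for e c
        by (rule W) (use len that in simp_all)
      moreover have "Suc a' + 0 + length ys \<le> length x" using len Suc by simp
      ultimately have "counts (program s) (length x) Read_B ys [n, Suc a', 0, n, Suc a']
          (if False \<notin> set ys \<and> length ys \<le> n \<and> Suc a' \<le> length ys
           then W n (Suc a') (0 + length ys - Suc a') else 0)"
        by (rule counts_Read_B[where W = "W n (Suc a')"])
      then have "counts (program s) (length x) Read_B ys [n, Suc a', 0, n, Suc a'] z"
        unfolding z_def add_0 .
      then have "counts (program s) (length x) Read_A (False # ys) [n, Suc a', 0, n, Suc a'] z"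
        by - (rule counts.read_bit, rule program.simps, simp)
      from counts_Read_First_A[OF this]
      have "counts (program s) (length x) Read_First_A y [n, 0, 0, n, 0] z"
        using len Suc zero by simp
      then show ?thesis
        using good[of n a' ys] start zero Suc \<open>x = replicate n True @ False # y\<close>
        unfolding z_def by simp
    qed
  qed
qed

text \<open>
  Reading the input leads to the registers \<open>n\<close>, \<open>a\<close>, \<open>b - a\<close> if the input is a string
  \<open>1\<^sup>n 0 1\<^sup>a 0 1\<^sup>b\<close> with \<open>1 \<le> a \<le> b \<le> n\<close>, and to rejection otherwise.
\<close>

lemma counts_program:
  assumes "\<And>n a e c V. n \<le> V \<Longrightarrow> a + e \<le> V \<Longrightarrow>
    counts (program s) V s [] [n, a, e, c, 0] (W n a e)"
  shows "\<exists>z. counts (program s) (length x) Read_N x (replicate 5 0) z \<and>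
    (\<forall>n a b. 1 \<le> a \<and> a \<le> b \<and> b \<le> n \<and> x = unary_triple n a b \<longrightarrow> z = W n a (b - a)) \<and>
    ((\<nexists>n a b. 1 \<le> a \<and> a \<le> b \<and> b \<le> n \<and> x = unary_triple n a b) \<longrightarrow> z = 0)"
proof -
  have five: "replicate 5 (0::nat) = [0, 0, 0, 0, 0]" by (simp add: eval_nat_numeral)
  show ?thesis
  proof (rule counts_program_cases[of s W x])
    show "counts (program s) V s [] [n, a, e, c, 0] (W n a e)" if "n \<le> V" "a + e \<le> V" for n a e c V
      using that by (rule assms)
  next
    assume "counts (program s) (length x) Read_N x [0, 0, 0, 0, 0] 0"
      and "\<And>n a b. x = unary_triple n a b \<Longrightarrow> a = 0"
    then show ?thesis unfolding five by (intro exI[of _ 0]) force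
  next
    fix n a ys
    let ?z = "if False \<notin> set ys \<and> length ys \<le> n \<and> Suc a \<le> length ys
      then W n (Suc a) (length ys - Suc a) else 0"
    assume good: "x = replicate n True @ False # replicate (Suc a) True @ False # ys"
      "counts (program s) (length x) Read_N x [0, 0, 0, 0, 0] ?z"
    have triple: "x = unary_triple n' a' b \<longleftrightarrow> n' = n \<and> a' = Suc a \<and> ys = replicate b True"
      for n' a' b
      unfolding good(1) eq_commute[of _ "unary_triple n' a' b"] unary_triple_eq_iff ones_zero_eq_iff
      by auto
    have ys: "ys = replicate (length ys) True" if "False \<notin> set ys"
      using that by (metis (full_types) replicate_length_same)
    have "?z = W n' a' (b - a')" if "1 \<le> a' \<and> a' \<le> b \<and> b \<le> n' \<and> x = unary_triple n' a' b" for n' a' b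
      using that unfolding triple by auto
    moreover have "?z = 0" if "\<nexists>n a b. 1 \<le> a \<and> a \<le> b \<and> b \<le> n \<and> x = unary_triple n a b"
    proof (rule ccontr)
      assume "?z \<noteq> 0"
      then have "False \<notin> set ys" "length ys \<le> n" "Suc a \<le> length ys" by (auto split: if_splits)
      moreover have "x = unary_triple n (Suc a) (length ys)"
        unfolding triple using ys \<open>False \<notin> set ys\<close> by simp
      ultimately show False using that by force
    qed
    ultimately show ?thesis using good(2) unfolding five by blast
  qed
qed

section \<open>Both differences are counted by log-space machines\<close>

lemma triple_fun_in_sharpL_program:
  assumes "\<And>n a e c V. n \<le> V \<Longrightarrow> a + e \<le> V \<Longrightarrow>
    counts (program s) V s [] [n, a, e, c, 0] (W n a e)"
    and D: "\<And>n a b. 1 \<le> a \<Longrightarrow> a \<le> b \<Longrightarrow> D n a b = W n a (b - a)"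
  shows "triple_fun_in_sharpL D"
proof -
  obtain z where z: "\<And>x. counts (program s) (length x) Read_N x (replicate 5 0) (z x)"
    "\<And>x n a b. 1 \<le> a \<and> a \<le> b \<and> b \<le> n \<and> x = unary_triple n a b \<Longrightarrow> z x = W n a (b - a)"
    "\<And>x. (\<nexists>n a b. 1 \<le> a \<and> a \<le> b \<and> b \<le> n \<and> x = unary_triple n a b) \<Longrightarrow> z x = 0"
    using counts_program[OF assms(1)] by metis
  have int_z: "int (nat (z x)) = z x" for x
    using counts_nonneg[OF z(1)[of x]] by simp
  have "(\<lambda>x. nat (z x)) \<in> sharpL"
  proof (rule counter_program_in_sharpL[of 5 "program s" Read_N])
    show "cmd_tape (program s l) < 5" for l by (cases l) auto
    show "counts (program s) (length x) Read_N x (replicate 5 0) (int (nat (z x)))" for x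
      unfolding int_z by (rule z(1))
  qed simp
  moreover have "int (nat (z (unary_triple n a b))) = D n a b" if "1 \<le> a \<and> a \<le> b \<and> b \<le> n" for n a b
    unfolding int_z using z(2)[of a b n] D that by simp
  moreover have "nat (z x) = 0" if "\<nexists>n a b. 1 \<le> a \<and> a \<le> b \<and> b \<le> n \<and> x = unary_triple n a b" for x
    using z(3)[OF that] by simp
  ultimately show ?thesis
    unfolding triple_fun_in_sharpL_def by (intro bexI[of _ "\<lambda>x. nat (z x)"]) blast+
qed

theorem corollary3p21:
  shows
    "triple_fun_in_sharpL (\<lambda>n a b.
       int (stirling n a) * int (stirling n b) -
       int (stirling n (a - 1)) * int (stirling n (b + 1))) \<and>
     triple_fun_in_sharpL (\<lambda>n a b.
       int (Stirling (n + a) n) * int (Stirling (n + b) n) -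
       int (Stirling (n + a - 1) n) * int (Stirling (n + b + 1) n))"
proof
  show "triple_fun_in_sharpL (\<lambda>n a b.
       int (stirling n a) * int (stirling n b) -
       int (stirling n (a - 1)) * int (stirling n (b + 1)))"
  proof (rule triple_fun_in_sharpL_program)
    show "counts (program Perm_Next) V Perm_Next [] [n, a, e, c, 0]
        (minor (cycle_num n) (cycle_num n) a e)" if "n \<le> V" "a + e \<le> V" for n a e c V
      using counts_Perm_Next that by simp
  qed (auto simp: minor_def cycle_num_def split: nat.split)
  show "triple_fun_in_sharpL (\<lambda>n a b.
       int (Stirling (n + a) n) * int (Stirling (n + b) n) -
       int (Stirling (n + a - 1) n) * int (Stirling (n + b + 1) n))"
  proof (rule triple_fun_in_sharpL_program)
    show "counts (program Part_B) V Part_B [] [n, a, e, c, 0]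
        (minor (block_num n) (block_num n) a e)" if "n \<le> V" "a + e \<le> V" for n a e c V
      using that by (intro counts_Part_B counts_Part_Next) simp_all
  qed (auto simp: minor_def block_num_def split: nat.split)
qed

end
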